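(* Let $k$ be a number field with ring of integers $\mathfrak o_k$ and let $L$ be an $\mathfrak o_k$-lattice with $\mathrm{rank}(L)\ge 2$. Then $L$ is potentially universal if and only if $1$ is potentially represented by $L$.
   Context: A quadratic space $(V,Q)$ over $k$ is a finite-dimensional $k$-vector space with a map $Q$ such that $B(x,y)=\frac12(Q(x+y)-Q(x)-Q(y))$ is a non-degenerate symmetric bilinear form. An $\mathfrak o_k$-lattice is a finitely generated $\mathfrak o_k$-module $L$ in such a space with $(kL,Q)$ non-degenerate; $Q(L)=\{Q(x):x\in L\}$. For a finite extension $K/k$ with ring of integers $\mathfrak o_K$, $\widetilde L=L\otimes_{\mathfrak o_k}\mathfrak o_K$ with the $K$-linear extension of $Q$. $L$ is potentially universal if there is a finite extension $K/k$ such that $\mathfrak o_k\subseteq Q(\widetilde L)$. An element $\alpha\in\mathfrak o_k$ is potentially represented by $L$ if there is a finite extension $K/k$ with $\alpha\in Q(\widetilde L)$. *)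

theory Defs
  imports
    "HOL-Algebra.Algebraic_Closure_Type"
    "HOL-Algebra.Free_Abelian_Groups"
    "HOL-Algebra.Coset"
    "HOL-Algebra.Generated_Groups"
begin

section \<open>Number fields and their finite extensions\<close>

text \<open>The base field is a whole type, which is a number field if it is spanned over the rationals
  by a finite set. A finite extension is realised inside the algebraic closure of the base field;
  every finite extension is isomorphic over the base field to one of this kind.\<close>

definition number_field :: "'k :: field_char_0 itself \<Rightarrow> bool" where
  "number_field _ \<longleftrightarrow>
     (\<exists>B :: 'k set. finite B \<and> module.span (\<lambda>(q :: rat) x. of_rat q * x) B = UNIV)"

definition finite_extension :: "'k :: field_char_0 alg_closure set \<Rightarrow> bool" where
  "finite_extension K \<longleftrightarrow>
     subfield K ring_of_type_algebra \<and> range to_ac \<subseteq> K \<and>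
     (\<exists>B. finite B \<and> module.span (\<lambda>(c :: 'k) x. to_ac c * x) B = K)"

definition ring_of_integers :: "'a :: field_char_0 set \<Rightarrow> 'a set" where
  "ring_of_integers K = {x \<in> K. algebraic_int x}"


section \<open>Quadratic spaces and lattices\<close>

definition polar_form :: "('v :: ab_group_add \<Rightarrow> 'k :: field_char_0) \<Rightarrow> 'v \<Rightarrow> 'v \<Rightarrow> 'k" where
  "polar_form Q x y = (Q (x + y) - Q x - Q y) / 2"

definition nondegenerate_on :: "'v set \<Rightarrow> ('v :: ab_group_add \<Rightarrow> 'k :: field_char_0) \<Rightarrow> bool" where
  "nondegenerate_on U Q \<longleftrightarrow> (\<forall>x\<in>U. (\<forall>y\<in>U. polar_form Q x y = 0) \<longrightarrow> x = 0)"

text \<open>Homogeneity of degree 2 is part of the notion of a quadratic form: bilinearity of the polar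
  form alone would allow adding a linear functional to \<open>Q\<close>. Together the conditions
  give \<open>Q x = polar_form Q x x\<close>. Symmetry of the polar form holds by its definition.\<close>

definition quadratic_space ::
    "('k :: field_char_0 \<Rightarrow> 'v :: ab_group_add \<Rightarrow> 'v) \<Rightarrow> ('v \<Rightarrow> 'k) \<Rightarrow> bool" where
  "quadratic_space scale Q \<longleftrightarrow>
     vector_space scale \<and>
     (\<exists>B. finite B \<and> module.span scale B = UNIV) \<and>
     (\<forall>c x. Q (scale c x) = c ^ 2 * Q x) \<and>
     (\<forall>x. Vector_Spaces.linear scale (*) (\<lambda>y. polar_form Q x y)) \<and>
     (\<forall>y. Vector_Spaces.linear scale (*) (\<lambda>x. polar_form Q x y)) \<and>
     nondegenerate_on UNIV Q"

definition quadratic_lattice ::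
    "('k :: field_char_0 \<Rightarrow> 'v :: ab_group_add \<Rightarrow> 'v) \<Rightarrow> ('v \<Rightarrow> 'k) \<Rightarrow> 'v set \<Rightarrow> bool" where
  "quadratic_lattice scale Q L \<longleftrightarrow>
     (\<exists>F. finite F \<and>
        L = {\<Sum>x\<in>F. scale (c x) x | c. \<forall>x\<in>F. c x \<in> ring_of_integers UNIV}) \<and>
     nondegenerate_on (module.span scale L) Q"

definition lattice_rank :: "('k :: field_char_0 \<Rightarrow> 'v :: ab_group_add \<Rightarrow> 'v) \<Rightarrow> 'v set \<Rightarrow> nat" where
  "lattice_rank scale L = vector_space.dim scale (module.span scale L)"


section \<open>Extension of scalars\<close>

text \<open>The tensor product of \<open>L\<close> with the ring of integers of \<open>K\<close>, over the ring of integers of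
  the base field, is the free abelian group on pairs modulo the bilinearity and balancing
  relations. Only its underlying abelian group is needed here.\<close>

inductive_set tensor_relations ::
    "('k :: field_char_0 \<Rightarrow> 'v :: ab_group_add \<Rightarrow> 'v) \<Rightarrow> 'v set \<Rightarrow> 'k alg_closure set \<Rightarrow>
     ('v \<times> 'k alg_closure \<Rightarrow>\<^sub>0 int) set"
  for scale L K where
  add_left: "x \<in> L \<Longrightarrow> y \<in> L \<Longrightarrow> a \<in> ring_of_integers K \<Longrightarrow>
     frag_of (x + y, a) - frag_of (x, a) - frag_of (y, a) \<in> tensor_relations scale L K"
| add_right: "x \<in> L \<Longrightarrow> a \<in> ring_of_integers K \<Longrightarrow> b \<in> ring_of_integers K \<Longrightarrow>
     frag_of (x, a + b) - frag_of (x, a) - frag_of (x, b) \<in> tensor_relations scale L K"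
| balanced: "x \<in> L \<Longrightarrow> a \<in> ring_of_integers K \<Longrightarrow> c \<in> ring_of_integers UNIV \<Longrightarrow>
     frag_of (scale c x, a) - frag_of (x, to_ac c * a) \<in> tensor_relations scale L K"

definition base_change ::
    "('k :: field_char_0 \<Rightarrow> 'v :: ab_group_add \<Rightarrow> 'v) \<Rightarrow> 'v set \<Rightarrow> 'k alg_closure set \<Rightarrow>
     ('v \<times> 'k alg_closure \<Rightarrow>\<^sub>0 int) set monoid" where
  "base_change scale L K =
     (let F = free_Abelian_group (L \<times> ring_of_integers K)
      in FactGroup F (generate F (tensor_relations scale L K)))"

text \<open>The extended bilinear form sends a pair of pure tensors, of \<open>x\<close> with \<open>a\<close> and of \<open>y\<close> with \<open>b\<close>,
  to \<open>a * b * polar_form Q x y\<close>. It is first defined on formal combinations of pairs; the quadratic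
  form on a coset is its value on the diagonal at any representative. Independence of the
  representative is \<open>extended_form_coset\<close> below.\<close>

definition formal_bilinear :: "('v :: ab_group_add \<Rightarrow> 'k :: field_char_0) \<Rightarrow>
    ('v \<times> 'k alg_closure \<Rightarrow>\<^sub>0 int) \<Rightarrow> ('v \<times> 'k alg_closure \<Rightarrow>\<^sub>0 int) \<Rightarrow> 'k alg_closure" where
  "formal_bilinear Q f g =
     (\<Sum>(x, a)\<in>Poly_Mapping.keys f. \<Sum>(y, b)\<in>Poly_Mapping.keys g.
        of_int (Poly_Mapping.lookup f (x, a)) * of_int (Poly_Mapping.lookup g (y, b)) *
        (a * b * to_ac (polar_form Q x y)))"

definition extended_form :: "('v :: ab_group_add \<Rightarrow> 'k :: field_char_0) \<Rightarrow>
    ('v \<times> 'k alg_closure \<Rightarrow>\<^sub>0 int) set \<Rightarrow> 'k alg_closure" where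
  "extended_form Q C = the_elem ((\<lambda>f. formal_bilinear Q f f) ` C)"

definition extended_values ::
    "('k :: field_char_0 \<Rightarrow> 'v :: ab_group_add \<Rightarrow> 'v) \<Rightarrow> ('v \<Rightarrow> 'k) \<Rightarrow> 'v set \<Rightarrow>
     'k alg_closure set \<Rightarrow> 'k alg_closure set" where
  "extended_values scale Q L K = extended_form Q ` carrier (base_change scale L K)"

definition potentially_universal ::
    "('k :: field_char_0 \<Rightarrow> 'v :: ab_group_add \<Rightarrow> 'v) \<Rightarrow> ('v \<Rightarrow> 'k) \<Rightarrow> 'v set \<Rightarrow> bool" where
  "potentially_universal scale Q L \<longleftrightarrow>
     (\<exists>K. finite_extension K \<and> to_ac ` ring_of_integers UNIV \<subseteq> extended_values scale Q L K)"

definition potentially_represented ::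
    "('k :: field_char_0 \<Rightarrow> 'v :: ab_group_add \<Rightarrow> 'v) \<Rightarrow> ('v \<Rightarrow> 'k) \<Rightarrow> 'v set \<Rightarrow> 'k \<Rightarrow> bool" where
  "potentially_represented scale Q L \<alpha> \<longleftrightarrow>
     (\<exists>K. finite_extension K \<and> to_ac \<alpha> \<in> extended_values scale Q L K)"


section \<open>The extended form is well defined\<close>

lemma formal_bilinear_superset:
  assumes "finite S" "finite T" "Poly_Mapping.keys f \<subseteq> S" "Poly_Mapping.keys g \<subseteq> T"
  shows "formal_bilinear Q f g =
     (\<Sum>p\<in>S. \<Sum>q\<in>T. of_int (Poly_Mapping.lookup f p) * of_int (Poly_Mapping.lookup g q) *
        (snd p * snd q * to_ac (polar_form Q (fst p) (fst q))))"
proof -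
  have "formal_bilinear Q f g =
     (\<Sum>p\<in>Poly_Mapping.keys f. \<Sum>q\<in>Poly_Mapping.keys g.
        of_int (Poly_Mapping.lookup f p) * of_int (Poly_Mapping.lookup g q) *
        (snd p * snd q * to_ac (polar_form Q (fst p) (fst q))))"
    by (simp add: formal_bilinear_def case_prod_unfold)
  also have "\<dots> = (\<Sum>p\<in>Poly_Mapping.keys f. \<Sum>q\<in>T.
        of_int (Poly_Mapping.lookup f p) * of_int (Poly_Mapping.lookup g q) *
        (snd p * snd q * to_ac (polar_form Q (fst p) (fst q))))"
    using assms by (intro sum.cong refl sum.mono_neutral_left) (auto simp: in_keys_iff)
  also have "\<dots> = (\<Sum>p\<in>S. \<Sum>q\<in>T.
        of_int (Poly_Mapping.lookup f p) * of_int (Poly_Mapping.lookup g q) *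
        (snd p * snd q * to_ac (polar_form Q (fst p) (fst q))))"
    using assms by (intro sum.mono_neutral_left) (auto simp: in_keys_iff)
  finally show ?thesis .
qed

lemma polar_form_commute: "polar_form Q x y = polar_form Q y x"
  by (simp add: polar_form_def algebra_simps)

lemma formal_bilinear_commute: "formal_bilinear Q f g = formal_bilinear Q g f"
  unfolding formal_bilinear_def case_prod_unfold
  by (subst sum.swap) (simp add: polar_form_commute mult_ac)

lemma formal_bilinear_add_left:
  "formal_bilinear Q (f + f') g = formal_bilinear Q f g + formal_bilinear Q f' g"
proof -
  let ?S = "Poly_Mapping.keys f \<union> Poly_Mapping.keys f'" and ?T = "Poly_Mapping.keys g"
  have "Poly_Mapping.keys (f + f') \<subseteq> ?S"
    by (rule Poly_Mapping.keys_add)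
  then show ?thesis
    by (simp add: formal_bilinear_superset[of ?S ?T] lookup_add distrib_right sum.distrib)
qed

lemma formal_bilinear_uminus_left: "formal_bilinear Q (- f) g = - formal_bilinear Q f g"
  using formal_bilinear_add_left[of Q f "- f" g]
  by (simp add: formal_bilinear_def[of _ 0] eq_neg_iff_add_eq_0 add.commute)

lemma formal_bilinear_diff_left:
  "formal_bilinear Q (f - f') g = formal_bilinear Q f g - formal_bilinear Q f' g"
  using formal_bilinear_add_left[of Q f "- f'" g] by (simp add: formal_bilinear_uminus_left)

lemma formal_bilinear_add_right:
  "formal_bilinear Q f (g + g') = formal_bilinear Q f g + formal_bilinear Q f g'"
  by (metis formal_bilinear_add_left formal_bilinear_commute)

lemma formal_bilinear_frag_of:
  "formal_bilinear Q (frag_of (x, a)) (frag_of (y, b)) = a * b * to_ac (polar_form Q x y)"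
  by (simp add: formal_bilinear_def)

lemma formal_bilinear_frag_of_left:
  "formal_bilinear Q (frag_of (x, a)) g =
     (\<Sum>q\<in>Poly_Mapping.keys g. of_int (Poly_Mapping.lookup g q) *
        (a * snd q * to_ac (polar_form Q x (fst q))))"
  by (simp add: formal_bilinear_def case_prod_unfold)

lemma formal_bilinear_relation:
  assumes "quadratic_space scale Q" "r \<in> tensor_relations scale L K"
  shows "formal_bilinear Q r g = 0"
proof -
  have lin: "Vector_Spaces.linear scale (*) (\<lambda>x. polar_form Q x y)" for y
    using assms(1) by (simp add: quadratic_space_def)
  have add: "polar_form Q (x + x') y = polar_form Q x y + polar_form Q x' y" for x x' y
    using module_hom.add[OF Vector_Spaces.linear.axioms(3)[OF lin]] .
  have scale: "polar_form Q (scale c x) y = c * polar_form Q x y" for c x y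
    using module_hom.scale[OF Vector_Spaces.linear.axioms(3)[OF lin]] .
  show ?thesis
    using assms(2)
    by cases (simp_all only: formal_bilinear_diff_left formal_bilinear_frag_of_left add scale
        to_ac_add to_ac_mult fst_conv snd_conv sum.distrib distrib_left distrib_right
        mult_ac add_diff_cancel_left' diff_self)
qed

lemma formal_bilinear_generate:
  assumes "quadratic_space scale Q"
    and "r \<in> generate (free_Abelian_group S) (tensor_relations scale L K)"
    and "\<And>r. r \<in> tensor_relations scale L K \<Longrightarrow> Poly_Mapping.keys r \<subseteq> S"
  shows "formal_bilinear Q r g = 0"
  using assms(2)
proof induction
  case one
  then show ?case by (simp add: formal_bilinear_def)
next
  case (incl h)
  then show ?case by (rule formal_bilinear_relation[OF assms(1)])
next
  case (inv h)
  then show ?case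
    using assms(3) formal_bilinear_relation[OF assms(1) inv]
    by (simp add: formal_bilinear_uminus_left)
next
  case (eng h1 h2)
  then show ?case by (simp add: formal_bilinear_add_left)
qed

text \<open>The hypothesis on the relations says that they lie in the free group; it holds as soon
  as \<open>L\<close> is closed under addition and integral scalars and \<open>K\<close> is an extension field.\<close>

lemma extended_form_coset:
  fixes L :: "'v :: ab_group_add set" and K :: "'k :: field_char_0 alg_closure set"
  defines "F \<equiv> free_Abelian_group (L \<times> ring_of_integers K)"
  assumes Q: "quadratic_space scale Q"
    and rel: "tensor_relations scale L K \<subseteq> carrier F"
  shows "extended_form Q (generate F (tensor_relations scale L K) #>\<^bsub>F\<^esub> f)
           = formal_bilinear Q f f"
proof -
  let ?H = "generate F (tensor_relations scale L K)"
  have zero: "formal_bilinear Q r g = 0" if "r \<in> ?H" for r g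
  proof (rule formal_bilinear_generate[OF Q that[unfolded F_def]])
    show "Poly_Mapping.keys r \<subseteq> L \<times> ring_of_integers K"
      if "r \<in> tensor_relations scale L K" for r
      using subsetD[OF rel that] by (simp add: F_def)
  qed
  have "(\<lambda>f. formal_bilinear Q f f) ` (?H #>\<^bsub>F\<^esub> f) = {formal_bilinear Q f f}"
  proof -
    have shift: "formal_bilinear Q (r + f) (r + f) = formal_bilinear Q f f" if "r \<in> ?H" for r
      using zero[OF that] formal_bilinear_commute[of Q f r]
      by (simp add: formal_bilinear_add_left formal_bilinear_add_right)
    have eq: "formal_bilinear Q h h = formal_bilinear Q f f" if "h \<in> ?H #>\<^bsub>F\<^esub> f" for h
    proof -
      from that obtain r where "r \<in> ?H" "h = r + f"
        unfolding r_coset_def by (auto simp: F_def)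
      then show ?thesis using shift by simp
    qed
    have "\<one>\<^bsub>F\<^esub> \<otimes>\<^bsub>F\<^esub> f \<in> ?H #>\<^bsub>F\<^esub> f"
      unfolding r_coset_def by (rule UN_I[OF generate.one]) simp
    then have "(?H #>\<^bsub>F\<^esub> f) \<noteq> {}"
      by (metis empty_iff)
    then show ?thesis
      by (simp add: eq image_constant_conv cong: image_cong_simp)
  qed
  then show ?thesis
    by (simp add: extended_form_def)
qed

end

theory Submission
  imports Defs
begin

text \<open>Over a finite extension, let \<open>v\<close> have norm 1. By non-degeneracy and rank at least 2 some \<open>w\<close>
  orthogonal to \<open>v\<close> is anisotropic, and after a further extension \<open>Q w = - c\<^sup>2\<close> with \<open>c\<close> integral. So
  it is enough that one finite extension represents every integer \<open>a\<close> of the base field as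
  \<open>x\<^sup>2 - c\<^sup>2 * y\<^sup>2 = (x - c * y) * (x + c * y)\<close>, that is, as a product of two integral factors that are
  congruent modulo \<open>2 * c\<close>. Let \<open>N\<close> be a positive multiple of \<open>4 * c\<^sup>2\<close>. There are finitely many
  residues modulo \<open>N\<close>, and each contains an algebraic integer \<open>e\<close> that divides \<open>N\<close>; every \<open>a\<close> in the
  class of \<open>e\<close> is \<open>f * (f + (N / f) * z)\<close> with \<open>f\<^sup>2 = e\<close> and \<open>z\<close> integral. The two factors
  are congruent modulo \<open>2 * c\<close> because \<open>(N / f)\<^sup>2\<close> is divisible by \<open>N\<close>.

  To find \<open>e\<close> in the class of \<open>r\<close>, two facts on the ring of all algebraic integers are used. It is
  a Bezout domain (finiteness of the class group), which gives \<open>r = d * p\<close> and \<open>N = d * q\<close> with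
  \<open>p\<close> and \<open>q\<close> comaximal; and every residue prime to the modulus contains a unit \<open>u\<close>, so that
  \<open>e = d * u\<close> with \<open>u\<close> congruent to \<open>p\<close> modulo \<open>q\<close>.\<close>

section \<open>Algebraic integers\<close>

text \<open>Nakayama's lemma by eliminating one \<open>v n\<close> after another, in place of a
  determinant. If \<open>1\<close> is not in \<open>J\<close>, then \<open>1 - c n n\<close> is
  nonzero, so \<open>v n\<close> vanishes once the other entries do, and these satisfy a smaller
  system with coefficients in \<open>J\<close>. Only a subring without unit is asked for, so that
  \<open>J\<close> can be an ideal as well as a set of values of polynomials without constant
  term.\<close>

lemma nakayama_elimination:
  fixes v :: "'i \<Rightarrow> 'a :: idom"
  assumes J: "0 \<in> J" "\<And>x y. x \<in> J \<Longrightarrow> y \<in> J \<Longrightarrow> x + y \<in> J"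
      "\<And>x y. x \<in> J \<Longrightarrow> y \<in> J \<Longrightarrow> x - y \<in> J" "\<And>x y. x \<in> J \<Longrightarrow> y \<in> J \<Longrightarrow> x * y \<in> J"
    and "finite I" "\<And>i j. i \<in> I \<Longrightarrow> j \<in> I \<Longrightarrow> c i j \<in> J"
    and "\<And>i. i \<in> I \<Longrightarrow> v i = (\<Sum>j\<in>I. c i j * v j)"
    and "i0 \<in> I" "v i0 \<noteq> 0"
  shows "1 \<in> J"
proof (rule ccontr)
  assume one: "1 \<notin> J"
  have "\<forall>i\<in>I. v i = 0"
    using assms(5-7)
  proof (induction I arbitrary: c rule: finite_induct)
    case (insert n I)
    \<comment> \<open>The equation of \<open>v i\<close>, multiplied by \<open>1 - c n n\<close>,
      lets \<open>v n\<close> be replaced without division. The surplus \<open>c n n * v i\<close>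
      moves to the right as a diagonal entry, so that \<open>v i\<close> has coefficient 1
      again.\<close>
    define c' where "c' i j = c i n * c n j + c i j - c n n * c i j + (if i = j then c n n else 0)" for i j
    have vn: "(1 - c n n) * v n = (\<Sum>j\<in>I. c n j * v j)"
      using insert.prems(2)[of n] insert.hyps by (simp add: algebra_simps)
    have "\<forall>i\<in>I. v i = 0"
    proof (rule insert.IH[of c'])
      fix i j assume "i \<in> I" "j \<in> I"
      then show "c' i j \<in> J" unfolding c'_def using insert.prems(1) by (auto intro!: J)
    next
      fix i assume i: "i \<in> I"
      have "v i = c i n * v n + (\<Sum>j\<in>I. c i j * v j)"
        using insert.prems(2)[of i] insert.hyps i by simp
      then have "(1 - c n n) * v i = c i n * ((1 - c n n) * v n) + (1 - c n n) * (\<Sum>j\<in>I. c i j * v j)"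
        by (simp add: algebra_simps)
      also have "\<dots> = (\<Sum>j\<in>I. (c i n * c n j + c i j - c n n * c i j) * v j)"
        unfolding vn by (simp add: sum_distrib_left sum.distrib[symmetric] sum_subtractf[symmetric] algebra_simps)
      finally have "v i = (\<Sum>j\<in>I. (c i n * c n j + c i j - c n n * c i j) * v j) + c n n * v i"
        by (simp add: algebra_simps)
      also have "c n n * v i = (\<Sum>j\<in>I. (if i = j then c n n else 0) * v j)"
        using i insert.hyps by (simp add: if_distrib[of "\<lambda>x. x * _"] sum.delta cong: if_cong)
      finally show "v i = (\<Sum>j\<in>I. c' i j * v j)"
        by (simp add: c'_def sum.distrib[symmetric] distrib_right)
    qed
    moreover have "v n = 0"
      using vn calculation one insert.prems(1)[of n n] by auto
    ultimately show ?case by simp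
  qed simp
  then show False using assms(8,9) by blast
qed

text \<open>Finitely generated stable modules occur over the integers, through
  \<open>of_int\<close>, and over the base field, through \<open>to_ac\<close>; both are
  instances.\<close>

locale ring_scalars =
  fixes h :: "'r :: comm_ring_1 \<Rightarrow> 'a :: comm_ring_1"
  assumes h_add: "h (c + d) = h c + h d" and h_mult: "h (c * d) = h c * h d" and h_one: "h 1 = 1"

sublocale ring_scalars \<subseteq> Modules.module "\<lambda>c x. h c * x"
  by standard (simp_all add: h_add h_mult h_one algebra_simps)

context ring_scalars
begin

lemma span_mult_closed:
  assumes "\<And>s. s \<in> S \<Longrightarrow> x * s \<in> span T" "y \<in> span S"
  shows "x * y \<in> span T"
  using assms(2)
proof (induction rule: span_induct_alt)
  case (step c s y)
  have "x * (h c * s + y) = h c * (x * s) + x * y" by (simp add: algebra_simps)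
  then show ?case using step assms(1) by (auto intro: span_add span_scale)
qed (simp add: span_zero)

text \<open>The products of \<open>S\<close> with the powers \<open>y ^ i\<close>,
  \<open>i < n\<close>, generate the new module, and the monic relation brings \<open>y ^ n\<close>
  back into it. The coefficients \<open>a i\<close> need not be scalars but only preserve the span
  of \<open>S\<close>; this yields that algebraic integers are integrally closed.\<close>

lemma stable_module_adjoin:
  assumes S: "finite S" "1 \<in> S" "\<And>x s. x \<in> M \<Longrightarrow> s \<in> S \<Longrightarrow> x * s \<in> span S"
    and n: "n > 0" "y ^ n = (\<Sum>i<n. a i * y ^ i)"
    and a: "\<And>i s. i < n \<Longrightarrow> s \<in> S \<Longrightarrow> a i * s \<in> span S"
  shows "\<exists>S'. finite S' \<and> 1 \<in> S' \<and> (\<forall>x\<in>insert y M. \<forall>s\<in>S'. x * s \<in> span S')"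
proof -
  define S' where "S' = (\<lambda>(i, s). y ^ i * s) ` ({..<n} \<times> S)"
  have mem: "y ^ i * s \<in> span S'" if "i < n" "s \<in> S" for i s
    unfolding S'_def using that by (intro span_base) auto
  have mem': "y ^ i * s \<in> span S'" if "i < n" "s \<in> span S" for i s
    using span_mult_closed[of S "y ^ i" S' s] mem that by blast
  show ?thesis
  proof (intro exI conjI ballI)
    show "finite S'" using S(1) by (simp add: S'_def)
    show "1 \<in> S'" using S(2) n(1) unfolding S'_def by (intro image_eqI[of _ _ "(0, 1)"]) auto
    fix x t assume x: "x \<in> insert y M" and "t \<in> S'"
    then obtain i s where t: "t = y ^ i * s" "i < n" "s \<in> S" by (auto simp: S'_def)
    show "x * t \<in> span S'"
    proof (cases "x \<in> M")
      case True
      have "y ^ i * (x * s) \<in> span S'" using t S(3) True by (intro mem') auto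
      then show ?thesis using t by (simp add: mult_ac)
    next
      case False
      then have [simp]: "x = y" using x by auto
      show ?thesis
      proof (cases "Suc i < n")
        case True
        have "y ^ Suc i * s \<in> span S'" using True t by (intro mem)
        then show ?thesis using t by (simp add: mult_ac)
      next
        case False
        then have "Suc i = n" using t by auto
        then have "x * t = y ^ n * s" using t by auto
        also have "\<dots> = (\<Sum>i<n. y ^ i * (a i * s))"
          unfolding n(2) sum_distrib_right by (simp add: mult_ac)
        also have "\<dots> \<in> span S'" using a t by (intro span_sum mem') auto
        finally show ?thesis .
      qed
    qed
  qed
qed

end

section \<open>Integrality by means of stable finitely generated groups\<close>

interpretation zmod: ring_scalars "of_int :: int \<Rightarrow> 'a :: comm_ring_1"
  by standard simp_all

abbreviation zspan :: "'a :: comm_ring_1 set \<Rightarrow> 'a set" where "zspan \<equiv> zmod.span"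

text \<open>Stability, divided by \<open>x\<close>, is a linear system on \<open>S\<close> with
  coefficients in the integral polynomials in \<open>inverse x\<close> without constant term.
  Elimination gives \<open>1 = poly p (inverse x)\<close> for such a \<open>p\<close>, and reversing
  the coefficients of \<open>1 - p\<close> gives a monic equation for \<open>x\<close>.\<close>

lemma algebraic_intI_stable:
  fixes x :: "'a :: field_char_0"
  assumes S: "finite S" "s \<in> S" "s \<noteq> 0" and stable: "\<And>s. s \<in> S \<Longrightarrow> x * s \<in> zspan S"
  shows "algebraic_int x"
proof (cases "x = 0")
  case False
  define J where "J = {poly p (inverse x) | p. (\<forall>i. Polynomial.coeff p i \<in> \<int>) \<and> Polynomial.coeff p 0 = 0}"
  have "\<forall>s\<in>S. \<exists>u. x * s = (\<Sum>t\<in>S. of_int (u t :: int) * t)"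
    using stable zmod.span_finite[OF S(1)] by fastforce
  then obtain u where u: "\<And>s. s \<in> S \<Longrightarrow> x * s = (\<Sum>t\<in>S. of_int (u s t :: int) * t)" by metis
  have "1 \<in> J"
  proof (rule nakayama_elimination[of J S "\<lambda>s t. of_int (u s t) * inverse x" "\<lambda>s. s" s])
    fix a b assume "a \<in> J" "b \<in> J"
    then obtain p q where pq: "a = poly p (inverse x)" "\<forall>i. Polynomial.coeff p i \<in> \<int>" "Polynomial.coeff p 0 = 0"
        "b = poly q (inverse x)" "\<forall>i. Polynomial.coeff q i \<in> \<int>" "Polynomial.coeff q 0 = 0" unfolding J_def by blast
    then show "a + b \<in> J" unfolding J_def by (intro CollectI exI[of _ "p + q"]) auto
    from pq show "a - b \<in> J" unfolding J_def by (intro CollectI exI[of _ "p - q"]) auto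
    have "\<forall>i. Polynomial.coeff (p * q) i \<in> \<int>"
      unfolding Polynomial.coeff_mult using pq by (intro allI Ints_sum Ints_mult) auto
    then show "a * b \<in> J" unfolding J_def using pq
      by (intro CollectI exI[of _ "p * q"]) (simp_all add: Polynomial.coeff_mult)
  next
    fix s t
    show "of_int (u s t) * inverse x \<in> J"
      unfolding J_def by (rule CollectI, rule exI[of _ "[:0, of_int (u s t):]"])
        (auto simp: coeff_pCons split: nat.splits)
  next
    fix s assume "s \<in> S"
    then have "s = inverse x * (x * s)" using False by simp
    also have "\<dots> = (\<Sum>t\<in>S. of_int (u s t) * inverse x * t)"
      using u[OF \<open>s \<in> S\<close>] by (simp add: sum_distrib_left mult_ac)
    finally show "s = (\<Sum>t\<in>S. of_int (u s t) * inverse x * t)" .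
  next
    show "0 \<in> J" unfolding J_def by (rule CollectI, rule exI[of _ 0]) simp
  qed (use S in auto)
  then obtain p where p: "1 = poly p (inverse x)" "\<forall>i. Polynomial.coeff p i \<in> \<int>" "Polynomial.coeff p 0 = 0"
    unfolding J_def by blast
  have "algebraic_int (inverse (inverse x))"
  proof (rule algebraic_int_inverse[of "1 - p"])
    show "\<forall>i. Polynomial.coeff (1 - p) i \<in> \<int>" using p(2) by (auto simp: coeff_1)
  qed (use p in auto)
  then show ?thesis by simp
qed simp

lemma monic_root_power:
  fixes y :: "'a :: comm_ring_1"
  assumes "lead_coeff p = 1" "poly p y = 0"
  shows "y ^ Polynomial.degree p = (\<Sum>i<Polynomial.degree p. (- Polynomial.coeff p i) * y ^ i)"
proof -
  have "0 = (\<Sum>i<Polynomial.degree p. Polynomial.coeff p i * y ^ i) + y ^ Polynomial.degree p"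
    using assms by (simp add: poly_altdef flip: lessThan_Suc_atMost)
  then show ?thesis by (simp add: sum_negf eq_neg_iff_add_eq_0 add.commute)
qed

lemma monic_root_degree_pos:
  fixes y :: "'a :: {comm_ring_1, ring_no_zero_divisors}"
  assumes "lead_coeff p = 1" "poly p y = 0"
  shows "Polynomial.degree p > 0"
  using assms by (intro Nat.gr0I) (auto elim!: Polynomial.degree_eq_zeroE)

text \<open>A single group that is stable under several algebraic integers is also stable under
  their sums and products; this is how these become integral.\<close>

lemma algebraic_int_stable_module:
  fixes M :: "'a :: field_char_0 set"
  assumes "finite M" "\<And>x. x \<in> M \<Longrightarrow> algebraic_int x"
  obtains S where "finite S" "1 \<in> S" "\<And>x s. x \<in> M \<Longrightarrow> s \<in> S \<Longrightarrow> x * s \<in> zspan S"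
proof -
  have "\<exists>S. finite S \<and> 1 \<in> S \<and> (\<forall>x\<in>M. \<forall>s\<in>S. x * s \<in> zspan S)"
    using assms
  proof (induction rule: finite_induct)
    case empty
    then show ?case by (intro exI[of _ "{1}"]) auto
  next
    case (insert y M)
    then obtain S where S: "finite S" "1 \<in> S" "\<And>x s. x \<in> M \<Longrightarrow> s \<in> S \<Longrightarrow> x * s \<in> zspan S"
      by auto
    from insert.prems obtain p where p: "lead_coeff p = 1" "\<forall>i. Polynomial.coeff p i \<in> \<int>" "poly p y = 0"
      by (auto simp: algebraic_int.simps)
    have coeff: "- Polynomial.coeff p i * s \<in> zspan S" if "s \<in> S" for i s
    proof -
      obtain c where "Polynomial.coeff p i = of_int c" using p(2) by (auto elim: Ints_cases)
      then show ?thesis using zmod.span_scale[OF zmod.span_base[OF that], of "- c"] by simp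
    qed
    show ?case
      by (rule zmod.stable_module_adjoin[OF S monic_root_degree_pos[OF p(1,3)] monic_root_power[OF p(1,3)] coeff])
  qed
  then show ?thesis using that by blast
qed

lemma algebraic_int_add [intro]: "algebraic_int (x + y)"
  and algebraic_int_times [intro]: "algebraic_int (x * y)"
  if "algebraic_int x" "algebraic_int y" for x y :: "'a :: field_char_0"
proof -
  obtain S where S: "finite S" "1 \<in> S" "\<And>z s. z \<in> {x, y} \<Longrightarrow> s \<in> S \<Longrightarrow> z * s \<in> zspan S"
    by (rule algebraic_int_stable_module[of "{x, y}"]) (use \<open>algebraic_int x\<close> \<open>algebraic_int y\<close> in auto)
  show "algebraic_int (x + y)"
    by (rule algebraic_intI_stable[OF S(1,2)]) (auto simp: distrib_right intro: zmod.span_add S)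
  show "algebraic_int (x * y)"
    by (rule algebraic_intI_stable[OF S(1,2)])
      (use zmod.span_mult_closed[of S x S] S(3) in \<open>auto simp: mult.assoc\<close>)
qed

lemma algebraic_int_diff [intro]: "algebraic_int (x - y)"
  if "algebraic_int x" "algebraic_int y" for x y :: "'a :: field_char_0"
  using algebraic_int_add[of x "- y"] that by auto

lemma algebraic_int_pow [intro]: "algebraic_int x \<Longrightarrow> algebraic_int (x ^ n)" for x :: "'a :: field_char_0"
  by (induction n) auto

lemma algebraic_int_sum [intro]: "(\<And>i. i \<in> I \<Longrightarrow> algebraic_int (f i)) \<Longrightarrow> algebraic_int (\<Sum>i\<in>I. f i)"
  for f :: "_ \<Rightarrow> 'a :: field_char_0"
  by (induction I rule: infinite_finite_induct) auto

text \<open>A group stable under all coefficients \<open>a i\<close> is enlarged by the powers of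
  \<open>y\<close> to one that is stable under \<open>y\<close>.\<close>

lemma algebraic_int_integrally_closed:
  fixes y :: "'a :: field_char_0"
  assumes "n > 0" "y ^ n = (\<Sum>i<n. a i * y ^ i)" "\<And>i. i < n \<Longrightarrow> algebraic_int (a i)"
  shows "algebraic_int y"
proof -
  obtain S where S: "finite S" "1 \<in> S" "\<And>x s. x \<in> a ` {..<n} \<Longrightarrow> s \<in> S \<Longrightarrow> x * s \<in> zspan S"
    by (rule algebraic_int_stable_module[of "a ` {..<n}"]) (use assms(3) in auto)
  have "\<exists>S'. finite S' \<and> 1 \<in> S' \<and> (\<forall>x\<in>insert y (a ` {..<n}). \<forall>s\<in>S'. x * s \<in> zspan S')"
    by (rule zmod.stable_module_adjoin[OF S assms(1,2)]) (use S(3) in auto)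
  then show ?thesis using algebraic_intI_stable[of _ 1 y] by auto
qed

lemma algebraic_int_root_power:
  fixes y :: "'a :: field_char_0"
  assumes "n > 0" "algebraic_int (y ^ n)"
  shows "algebraic_int y"
proof (rule algebraic_int_integrally_closed[OF assms(1)])
  show "y ^ n = (\<Sum>i<n. (if i = 0 then y ^ n else 0) * y ^ i)"
    using assms(1) by (simp add: if_distrib[of "\<lambda>x. x * _"] sum.delta' cong: if_cong)
qed (use assms in auto)

section \<open>Integral coordinates of a number field\<close>

interpretation qvec: Vector_Spaces.vector_space "\<lambda>(q :: rat) (x :: 'k :: field_char_0). of_rat q * x"
  by standard (simp_all add: algebra_simps of_rat_add of_rat_mult)

lemma common_denominator:
  assumes "finite (S :: rat set)"
  shows "\<exists>D > 0. \<forall>q\<in>S. of_nat D * q \<in> \<int>"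
  using assms
proof (induction rule: finite_induct)
  case empty
  then show ?case by (intro exI[of _ 1]) auto
next
  case (insert q S)
  then obtain D where D: "D > 0" "\<forall>q\<in>S. of_nat D * q \<in> \<int>" by blast
  obtain a b where ab: "b > 0" "q = of_int a / of_int b" by (metis Rat_cases Fract_of_int_quotient)
  have "of_nat (D * nat b) * q = of_int (int D * a)" using ab by simp
  moreover have "of_nat (D * nat b) * r \<in> \<int>" if "r \<in> S" for r
  proof -
    have "of_nat (D * nat b) * r = of_nat (nat b) * (of_nat D * r)" by simp
    then show ?thesis using D(2) that by (metis Ints_mult Ints_of_nat)
  qed
  ultimately have "\<forall>r\<in>insert q S. of_nat (D * nat b) * r \<in> \<int>" by (metis Ints_of_int insertE)
  then show ?case using D(1) ab(1) by (intro exI[of _ "D * nat b"]) simp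
qed

text \<open>A rational basis \<open>w\<close> of the field with integral structure constants. Its
  integral span, \<open>lat\<close> below, is closed under multiplication and stands in for the ring
  of integers; it need not contain 1.\<close>

locale integral_coordinates =
  fixes I :: "'i set" and w :: "'i \<Rightarrow> 'k :: field_char_0" and co :: "'k \<Rightarrow> 'i \<Rightarrow> rat"
  assumes finite_I: "finite I"
    and co_expand: "(\<Sum>i\<in>I. of_rat (co x i) * w i) = x"
    and co_add: "co (x + y) i = co x i + co y i"
    and co_scale: "co (of_rat q * x) i = q * co x i"
    and co_w: "i \<in> I \<Longrightarrow> j \<in> I \<Longrightarrow> co (w i) j = (if i = j then 1 else 0)"
    and co_w_w: "i \<in> I \<Longrightarrow> j \<in> I \<Longrightarrow> co (w i * w j) l \<in> \<int>"

lemma number_field_coordinates: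
  assumes "number_field TYPE('k :: field_char_0)"
  shows "\<exists>(I :: 'k set) (w :: 'k \<Rightarrow> 'k) co. integral_coordinates I w co"
proof -
  obtain B0 :: "'k set" where B0: "finite B0" "qvec.span B0 = UNIV"
    using assms by (auto simp: number_field_def)
  obtain B where B: "B \<subseteq> B0" "qvec.independent B" "qvec.span B = UNIV"
  proof (rule qvec.maximal_independent_subset[of B0])
    fix B assume B: "B \<subseteq> B0" "qvec.independent B" "B0 \<subseteq> qvec.span B"
    then have "qvec.span B = UNIV"
      using qvec.span_mono[OF B(3)] B0(2) by (simp add: qvec.span_span top.extremum_unique)
    then show thesis using that B by blast
  qed
  have fin: "finite B" using B(1) B0(1) finite_subset by blast
  let ?r = "qvec.representation B"
  obtain D where D: "D > 0" "\<And>u v l. u \<in> B \<Longrightarrow> v \<in> B \<Longrightarrow> l \<in> B \<Longrightarrow> of_nat D * ?r (u * v) l \<in> \<int>"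
    using common_denominator[of "(\<lambda>(u, v, l). ?r (u * v) l) ` (B \<times> B \<times> B)"] fin by fastforce
  have zero: "?r x l = 0" if "l \<notin> B" for x l
    using that qvec.representation_ne_zero by blast
  have rep_scale: "?r (of_rat q * x) l = q * ?r x l" for q x l
    using qvec.representation_scale[OF B(2), of x q] B(3) by simp
  \<comment> \<open>Scaling a basis by \<open>D\<close> also multiplies its structure constants by
    \<open>D\<close>, since a product gains two factors and the basis element absorbs one. So a
    common denominator of the constants suffices.\<close>
  have "integral_coordinates B (\<lambda>b. of_nat D * b) (\<lambda>x b. ?r x b / of_nat D)"
  proof
    fix x y :: 'k and q :: rat and i
    have "(\<Sum>i\<in>B. of_rat (?r x i) * i) = x"
      using qvec.sum_representation_eq[of B x B] B fin by simp
    then show "(\<Sum>i\<in>B. of_rat (?r x i / of_nat D) * (of_nat D * i)) = x"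
      using D(1) by (simp add: of_rat_divide)
    show "?r (x + y) i / of_nat D = ?r x i / of_nat D + ?r y i / of_nat D"
      using qvec.representation_add[OF B(2), of y x] B(3) by (simp add: add_divide_distrib)
    show "?r (of_rat q * x) i / of_nat D = q * (?r x i / of_nat D)"
      by (simp add: rep_scale)
  next
    fix i j assume ij: "i \<in> B" "j \<in> B"
    have "?r (of_rat (of_nat D) * i) j = of_nat D * ?r i j"
      by (rule rep_scale)
    then show "?r (of_nat D * i) j / of_nat D = (if i = j then 1 else 0)"
      using qvec.representation_basis[OF B(2) ij(1)] D(1) by simp
    fix l
    have eq: "of_nat D * i * (of_nat D * j) = of_rat (of_nat D) * (of_rat (of_nat D) * (i * j))"
      by (simp add: mult_ac)
    have "?r (of_nat D * i * (of_nat D * j)) l / of_nat D = of_nat D * ?r (i * j) l"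
      unfolding eq rep_scale using D(1) by simp
    then show "?r (of_nat D * i * (of_nat D * j)) l / of_nat D \<in> \<int>"
      using D(2)[OF ij, of l] zero[of l] by (cases "l \<in> B") auto
  qed (use fin in auto)
  then show ?thesis by blast
qed

context integral_coordinates
begin

lemma co_zero: "co 0 i = 0"
  using co_scale[of 0 0 i] by simp

lemma co_minus: "co (- x) i = - co x i"
  using co_scale[of "-1" x i] by simp

lemma co_diff: "co (x - y) i = co x i - co y i"
  using co_add[of x "- y" i] by (simp add: co_minus)

lemma co_of_nat: "co (of_nat n * x) i = of_nat n * co x i"
  using co_scale[of "of_nat n" x i] by simp

lemma co_sum: "co (\<Sum>j\<in>J. f j) i = (\<Sum>j\<in>J. co (f j) i)"
  by (induction J rule: infinite_finite_induct) (auto simp: co_zero co_add)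

lemma co_combination: "i \<in> I \<Longrightarrow> co (\<Sum>j\<in>I. of_rat (q j) * w j) i = q i"
proof -
  assume i: "i \<in> I"
  have "co (\<Sum>j\<in>I. of_rat (q j) * w j) i = (\<Sum>j\<in>I. q j * co (w j) i)"
    by (simp add: co_sum co_scale)
  also have "\<dots> = (\<Sum>j\<in>I. if j = i then q j else 0)"
    using i by (intro sum.cong) (auto simp: co_w)
  finally show ?thesis using i finite_I by simp
qed

lemma co_eqI: "(\<And>i. i \<in> I \<Longrightarrow> co x i = co y i) \<Longrightarrow> x = y"
proof -
  assume "\<And>i. i \<in> I \<Longrightarrow> co x i = co y i"
  then have "(\<Sum>i\<in>I. of_rat (co x i) * w i) = (\<Sum>i\<in>I. of_rat (co y i) * w i)" by simp
  then show "x = y" by (simp only: co_expand)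
qed

lemma co_mult: "co (x * y) l = (\<Sum>i\<in>I. \<Sum>j\<in>I. co x i * co y j * co (w i * w j) l)"
proof -
  have "x * y = (\<Sum>i\<in>I. \<Sum>j\<in>I. of_rat (co x i * co y j) * (w i * w j))"
  proof -
    have "x * y = (\<Sum>i\<in>I. of_rat (co x i) * w i) * (\<Sum>j\<in>I. of_rat (co y j) * w j)"
      by (simp only: co_expand)
    then show ?thesis by (simp only: sum_product of_rat_mult mult_ac)
  qed
  then show ?thesis by (simp add: co_sum co_scale)
qed

section \<open>The lattice of the basis, heights and simultaneous approximation\<close>

definition lat :: "'k set" where "lat = {x. \<forall>i\<in>I. co x i \<in> \<int>}"

lemma lat_closed:
  "0 \<in> lat" "x \<in> lat \<Longrightarrow> y \<in> lat \<Longrightarrow> x + y \<in> lat" "x \<in> lat \<Longrightarrow> y \<in> lat \<Longrightarrow> x - y \<in> lat"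
  "x \<in> lat \<Longrightarrow> of_nat n * x \<in> lat" "i \<in> I \<Longrightarrow> w i \<in> lat"
  by (simp_all add: lat_def co_zero co_add co_diff co_of_nat co_w)

lemma lat_mult_closed: "x \<in> lat \<Longrightarrow> y \<in> lat \<Longrightarrow> x * y \<in> lat"
  unfolding lat_def
  by (intro CollectI ballI, subst co_mult) (intro Ints_sum Ints_mult co_w_w; simp)

lemma co_int_combination: "i \<in> I \<Longrightarrow> co (\<Sum>j\<in>I. of_int (c j) * w j) i = of_int (c i)"
  using co_combination[of i "\<lambda>i. of_int (c i)"] by (simp only: of_rat_of_int_eq)

lemma combination_in_lat: "(\<Sum>i\<in>I. of_int (c i) * w i) \<in> lat"
  by (simp add: lat_def co_int_combination)

lemma exists_denominator: "\<exists>D > 0. of_nat D * x \<in> lat"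
proof -
  obtain D where "D > 0" "\<forall>q\<in>co x ` I. of_nat D * q \<in> \<int>"
    using common_denominator[of "co x ` I"] finite_I by auto
  then show ?thesis by (auto simp: lat_def co_of_nat)
qed

definition height :: "'k \<Rightarrow> rat" where "height x = (\<Sum>i\<in>I. \<bar>co x i\<bar>)"

lemma height_mult: "\<exists>C > 0. \<forall>x y. height (x * y) \<le> C * height x * height y"
proof -
  \<comment> \<open>The heights of the finitely many products of basis elements bound the bilinear
    multiplication; the summand 1 makes the constant positive.\<close>
  define C where "C = 1 + (\<Sum>i\<in>I. \<Sum>j\<in>I. height (w i * w j))"
  have nonneg: "height x \<ge> 0" for x unfolding height_def by (intro sum_nonneg) auto
  have C: "height (w i * w j) \<le> C" if "i \<in> I" "j \<in> I" for i j
  proof -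
    have "height (w i * w j) \<le> (\<Sum>j\<in>I. height (w i * w j))"
      using that finite_I nonneg by (intro member_le_sum[of j I "\<lambda>j. height (w i * w j)"]) auto
    also have "\<dots> \<le> (\<Sum>i\<in>I. \<Sum>j\<in>I. height (w i * w j))"
      using that finite_I nonneg
      by (intro member_le_sum[of i I "\<lambda>i. \<Sum>j\<in>I. height (w i * w j)"] sum_nonneg) auto
    finally show ?thesis by (simp add: C_def)
  qed
  have "height (x * y) \<le> C * height x * height y" for x y
  proof -
    have "height (x * y) \<le> (\<Sum>l\<in>I. \<Sum>i\<in>I. \<Sum>j\<in>I. \<bar>co x i\<bar> * \<bar>co y j\<bar> * \<bar>co (w i * w j) l\<bar>)"
      unfolding height_def
    proof (rule sum_mono)
      fix l
      have "\<bar>co (x * y) l\<bar> \<le> (\<Sum>i\<in>I. \<bar>\<Sum>j\<in>I. co x i * co y j * co (w i * w j) l\<bar>)"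
        unfolding co_mult[of x y] by (rule sum_abs)
      also have "\<dots> \<le> (\<Sum>i\<in>I. \<Sum>j\<in>I. \<bar>co x i * co y j * co (w i * w j) l\<bar>)"
        by (intro sum_mono sum_abs)
      finally show "\<bar>co (x * y) l\<bar> \<le> (\<Sum>i\<in>I. \<Sum>j\<in>I. \<bar>co x i\<bar> * \<bar>co y j\<bar> * \<bar>co (w i * w j) l\<bar>)"
        by (simp add: abs_mult)
    qed
    also have "\<dots> = (\<Sum>i\<in>I. \<Sum>j\<in>I. \<bar>co x i\<bar> * \<bar>co y j\<bar> * height (w i * w j))"
      unfolding height_def sum_distrib_left
      by (subst sum.swap, rule sum.cong[OF refl], rule sum.swap)
    also have "\<dots> \<le> (\<Sum>i\<in>I. \<Sum>j\<in>I. \<bar>co x i\<bar> * \<bar>co y j\<bar> * C)"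
      by (intro sum_mono mult_left_mono C) auto
    also have "\<dots> = C * height x * height y"
    proof -
      have "height x * height y * C = (\<Sum>i\<in>I. \<Sum>j\<in>I. \<bar>co x i\<bar> * \<bar>co y j\<bar> * C)"
        unfolding height_def by (subst sum_product) (simp only: sum_distrib_right)
      then show ?thesis by (simp add: mult_ac)
    qed
    finally show ?thesis .
  qed
  moreover have "C > 0" unfolding C_def by (intro add_pos_nonneg sum_nonneg nonneg) auto
  ultimately show ?thesis by blast
qed

text \<open>Pigeonhole: the fractional parts of the coordinates of \<open>t * y\<close>, for the
  \<open>m ^ card I + 1\<close> values \<open>t \<le> m ^ card I\<close>, fall into
  \<open>m ^ card I\<close> cubes of side \<open>1 / m\<close>. Two multiples in the same cube
  differ by nearly a lattice point.\<close>

lemma dirichlet_approximation: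
  assumes "m > 0"
  shows "\<exists>t x. 0 < t \<and> t \<le> m ^ card I \<and> x \<in> lat \<and> height (of_nat t * y - x) \<le> of_nat (card I) / of_nat m"
proof -
  define F where "F t = (\<lambda>i\<in>I. \<lfloor>of_nat m * frac (of_nat t * co y i)\<rfloor>)" for t :: nat
  have "F t \<in> I \<rightarrow>\<^sub>E {0..<int m}" for t
  proof -
    have "of_nat m * frac (of_nat t * co y i) < of_nat m" for i
      using assms frac_lt_1[of "of_nat t * co y i"] by simp
    then show ?thesis
      by (simp add: F_def restrict_PiE_iff floor_less_iff frac_ge_0)
  qed
  then have "F ` {..m ^ card I} \<subseteq> I \<rightarrow>\<^sub>E {0..<int m}" by blast
  then have "card (F ` {..m ^ card I}) \<le> m ^ card I"
    using card_mono[of "I \<rightarrow>\<^sub>E {0..<int m}"] finite_I by (simp add: card_PiE finite_PiE)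
  then have "\<not> inj_on F {..m ^ card I}"
    by (intro pigeonhole) simp
  then obtain t1 t2 where t: "t1 < t2" "t2 \<le> m ^ card I" "F t1 = F t2"
    unfolding inj_on_def by (metis atMost_iff linorder_neqE_nat)
  define c where "c i = \<lfloor>of_nat t2 * co y i\<rfloor> - \<lfloor>of_nat t1 * co y i\<rfloor>" for i
  define x where "x = (\<Sum>i\<in>I. of_int (c i) * w i)"
  have "\<bar>co (of_nat (t2 - t1) * y - x) i\<bar> \<le> 1 / of_nat m" if "i \<in> I" for i
  proof -
    let ?a = "frac (of_nat t2 * co y i)" and ?b = "frac (of_nat t1 * co y i)"
    have "co (of_nat (t2 - t1) * y - x) i = ?a - ?b"
    proof -
      have "co (of_nat (t2 - t1) * y - x) i = of_nat (t2 - t1) * co y i - of_int (c i)"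
        using co_int_combination[OF that, of c, folded x_def] by (simp only: co_diff co_of_nat)
      also have "\<dots> = ?a - ?b"
        using t(1) by (simp add: frac_def c_def of_nat_diff left_diff_distrib)
      finally show ?thesis .
    qed
    moreover have "\<lfloor>of_nat m * ?a\<rfloor> = \<lfloor>of_nat m * ?b\<rfloor>"
      using fun_cong[OF t(3), of i] that by (simp add: F_def)
    then have "\<bar>of_nat m * ?a - of_nat m * ?b\<bar> < 1"
      by linarith
    then have "\<bar>?a - ?b\<bar> < 1 / of_nat m"
      using assms by (simp add: abs_mult pos_less_divide_eq mult.commute flip: right_diff_distrib)
    ultimately show ?thesis by simp
  qed
  then have "height (of_nat (t2 - t1) * y - x) \<le> (\<Sum>i\<in>I. 1 / of_nat m)"
    unfolding height_def by (rule sum_mono)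
  moreover have "x \<in> lat" unfolding x_def by (rule combination_in_lat)
  ultimately show ?thesis using t(1,2) by (intro exI[of _ "t2 - t1"] exI[of _ x]) auto
qed

end

lemma algebraic_int_to_ac:
  fixes x :: "'k :: field_char_0"
  assumes "algebraic_int x"
  shows "algebraic_int (to_ac x)"
proof -
  obtain p :: "int poly" where p: "poly (map_poly of_int p) x = 0" "lead_coeff p = 1"
    using assms unfolding algebraic_int_altdef_ipoly by blast
  have "poly (map_poly of_int p) (to_ac x) = to_ac (poly (map_poly of_int p) x)"
    by (simp add: poly_altdef degree_map_poly coeff_map_poly to_ac_sum)
  then show ?thesis unfolding algebraic_int_altdef_ipoly using p by auto
qed

context integral_coordinates
begin

lemma height_pos: "x \<noteq> 0 \<Longrightarrow> height x > 0"
proof (rule ccontr)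
  assume x: "x \<noteq> 0" "\<not> height x > 0"
  have "height x \<ge> 0" by (simp add: height_def sum_nonneg)
  then have "(\<Sum>i\<in>I. \<bar>co x i\<bar>) = 0" using x(2) unfolding height_def by linarith
  then have "\<forall>i\<in>I. co x i = 0" by (subst (asm) sum_nonneg_eq_0_iff) (auto simp: finite_I)
  then show False using co_eqI[of x 0] x(1) by (simp add: co_zero)
qed

lemma height_denominator: "of_nat D * x \<in> lat \<Longrightarrow> of_nat D * height x \<in> \<int>"
  unfolding height_def sum_distrib_left
proof (rule Ints_sum)
  fix i assume "of_nat D * x \<in> lat" "i \<in> I"
  then have "co (of_nat D * x) i \<in> \<int>" by (simp add: lat_def)
  then have "\<bar>of_nat D * co x i\<bar> \<in> \<int>" by (simp only: co_of_nat Ints_abs)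
  then show "of_nat D * \<bar>co x i\<bar> \<in> \<int>" by (simp add: abs_mult)
qed

text \<open>Nonzero fractional ideals of \<open>lat\<close>; the closure condition has the shape of
  the remainder in a division by an element of the module.\<close>

definition fractional_module :: "'k set \<Rightarrow> bool" where
  "fractional_module A \<longleftrightarrow> (\<exists>x\<in>A. x \<noteq> 0) \<and> (\<exists>D > 0. \<forall>x\<in>A. of_nat D * x \<in> lat) \<and>
     (\<forall>t. \<forall>x\<in>A. \<forall>l\<in>lat. \<forall>y\<in>A. of_nat t * x - l * y \<in> A)"

text \<open>Division with remainder up to a bounded multiplier: for \<open>b\<close> of least height
  in \<open>A\<close>, the quotient \<open>x / b\<close> is approximated so well that
  \<open>t * x - l * b\<close> would be of smaller height than \<open>b\<close>, hence is 0. The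
  essential point is that \<open>T\<close> does not depend on \<open>A\<close>.\<close>

lemma almost_principal:
  "\<exists>T > 0. \<forall>A. fractional_module A \<longrightarrow>
     (\<exists>b\<in>A. b \<noteq> 0 \<and> (\<forall>x\<in>A. \<exists>l\<in>lat. of_nat T * x = b * l))"
proof -
  obtain C where C: "C > 0" "\<And>x y. height (x * y) \<le> C * height x * height y" using height_mult by blast
  \<comment> \<open>An approximation to within \<open>card I / m\<close> then makes the height of
    the remainder smaller than that of \<open>b\<close>, whatever \<open>b\<close> is.\<close>
  obtain m :: nat where "of_nat m > C * of_nat (card I)" using reals_Archimedean2 by blast
  moreover have "C * of_nat (card I) \<ge> 0" using C(1) by simp
  ultimately have m: "m > 0" "C * of_nat (card I) / of_nat m < 1"
    by (auto intro!: Nat.gr0I simp: divide_less_eq)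
  \<comment> \<open>The factorial is a multiple of every denominator \<open>t\<close> that the
    approximation can produce.\<close>
  let ?T = "fact (m ^ card I) :: nat"
  have "\<exists>b\<in>A. b \<noteq> 0 \<and> (\<forall>x\<in>A. \<exists>l\<in>lat. of_nat ?T * x = b * l)"
    if "fractional_module A" for A
  proof -
    obtain a D where A: "a \<in> A" "a \<noteq> 0" and D: "D > 0" "\<forall>x\<in>A. of_nat D * x \<in> lat"
      and closed: "\<forall>t. \<forall>x\<in>A. \<forall>l\<in>lat. \<forall>y\<in>A. of_nat t * x - l * y \<in> A"
      using \<open>fractional_module A\<close> unfolding fractional_module_def by (elim conjE bexE exE)
    \<comment> \<open>Multiplied by the common denominator \<open>D\<close> of \<open>A\<close>,
      heights are natural numbers, so a least one exists.\<close>
    let ?f = "\<lambda>x. nat \<lfloor>of_nat D * height x\<rfloor>"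
    obtain b where b: "b \<in> A" "b \<noteq> 0" "\<And>y. y \<in> A \<Longrightarrow> y \<noteq> 0 \<Longrightarrow> ?f b \<le> ?f y"
      using ex_has_least_nat[of "\<lambda>x. x \<in> A \<and> x \<noteq> 0" a ?f] A by blast
    have "\<exists>l\<in>lat. of_nat ?T * x = b * l" if x: "x \<in> A" for x
    proof -
      obtain t l where t: "0 < t" "t \<le> m ^ card I" "l \<in> lat"
          "height (of_nat t * (x / b) - l) \<le> of_nat (card I) / of_nat m"
        using dirichlet_approximation[OF m(1)] by blast
      have eq: "of_nat t * x - l * b = b * (of_nat t * (x / b) - l)"
        using b(2) by (simp add: field_simps)
      have zero: "of_nat t * x - l * b = 0"
      proof (rule ccontr)
        let ?g = "of_nat t * x - l * b"
        assume nz: "?g \<noteq> 0"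
        have gA: "?g \<in> A" using closed x t(3) b(1) by blast
        have "height ?g \<le> C * height b * height (of_nat t * (x / b) - l)"
          unfolding eq by (rule C(2))
        also have "\<dots> \<le> C * height b * (of_nat (card I) / of_nat m)"
          using C(1) height_pos[OF b(2)] by (intro mult_left_mono t(4)) auto
        also have "\<dots> = height b * (C * of_nat (card I) / of_nat m)" by simp
        also have "\<dots> < height b * 1"
          by (rule mult_strict_left_mono[OF m(2) height_pos[OF b(2)]])
        finally have less: "of_nat D * height ?g < of_nat D * height b" using D(1) by simp
        obtain u v where uv: "of_nat D * height ?g = of_int u" "of_nat D * height b = of_int v"
          using height_denominator D(2) gA b(1) by (metis Ints_cases)
        have "of_nat D * height ?g > 0" using D(1) height_pos[OF nz] by simp
        then have "nat u < nat v" using less unfolding uv by simp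
        then have "?f ?g < ?f b" unfolding uv floor_of_int .
        then show False using b(3)[OF gA nz] by (meson leD)
      qed
      have "t dvd ?T" using t(1,2) by (intro dvd_fact) auto
      then obtain k where k: "?T = t * k" by blast
      have "of_nat ?T * x = b * (of_nat k * l)"
        unfolding k using zero by (simp add: mult_ac)
      then show ?thesis using lat_closed(4)[OF t(3)] by blast
    qed
    then show ?thesis using b(1,2) by blast
  qed
  then show ?thesis by (intro exI[of _ ?T] conjI fact_gt_zero allI impI) blast
qed

section \<open>Groups between \<open>lat\<close> and its multiple by \<open>1 / T\<close>\<close>

lemma lat_sum: "(\<And>j. j \<in> J \<Longrightarrow> f j \<in> lat) \<Longrightarrow> (\<Sum>j\<in>J. f j) \<in> lat"
  by (induction J rule: infinite_finite_induct) (simp_all add: lat_closed)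

definition box :: "nat \<Rightarrow> 'k set" where
  "box T = (\<lambda>c. \<Sum>i\<in>I. of_int (c i) * w i) ` (I \<rightarrow>\<^sub>E {0..<int T})"

lemma finite_box: "finite (box T)"
  unfolding box_def by (intro finite_imageI finite_PiE finite_I) simp

text \<open>A group between \<open>lat\<close> and \<open>lat / T\<close> is a union of cosets of
  \<open>lat\<close>. The quotients \<open>r / T\<close> with \<open>r\<close> in
  \<open>box T\<close> represent all cosets, so their membership determines the group; as the box is
  finite, only finitely many such groups exist.\<close>

lemma lattice_trace_mono:
  assumes T: "T > 0" and B: "lat \<subseteq> B" "\<And>x y. x \<in> B \<Longrightarrow> y \<in> B \<Longrightarrow> x - y \<in> B"
      "\<And>x. x \<in> B \<Longrightarrow> of_nat T * x \<in> lat"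
    and B': "lat \<subseteq> B'" "\<And>x y. x \<in> B' \<Longrightarrow> y \<in> B' \<Longrightarrow> x + y \<in> B'"
    and trace: "{x \<in> box T. x / of_nat T \<in> B} \<subseteq> {x \<in> box T. x / of_nat T \<in> B'}"
  shows "B \<subseteq> B'"
proof
  fix x assume x: "x \<in> B"
  have "\<forall>i\<in>I. \<exists>c. co (of_nat T * x) i = of_int c"
    using B(3)[OF x] by (auto simp: lat_def elim: Ints_cases)
  then obtain c where c: "\<And>i. i \<in> I \<Longrightarrow> co (of_nat T * x) i = of_int (c i)" by metis
  \<comment> \<open>Division of the coordinates by \<open>T\<close> with remainder: \<open>x\<close>
    is \<open>q\<close> from \<open>lat\<close> plus the representative
    \<open>r / T\<close>.\<close>
  define q where "q = (\<Sum>i\<in>I. of_int (c i div int T) * w i)"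
  define r where "r = (\<Sum>i\<in>I. of_int (restrict (\<lambda>i. c i mod int T) I i) * w i)"
  have "of_nat T * x = of_nat T * q + r"
  proof (rule co_eqI)
    fix i assume i: "i \<in> I"
    have "co (of_nat T * q + r) i = of_nat T * of_int (c i div int T) + of_int (c i mod int T)"
      unfolding co_add co_of_nat q_def r_def co_int_combination[OF i] using i by simp
    also have "\<dots> = of_int (int T * (c i div int T) + c i mod int T)" by (simp only: of_int_add of_int_mult of_int_of_nat_eq)
    finally show "co (of_nat T * x) i = co (of_nat T * q + r) i" using c[OF i] by (simp only: mult_div_mod_eq)
  qed
  then have x_eq: "x = q + r / of_nat T" using T by (simp add: field_simps)
  have q: "q \<in> lat" unfolding q_def by (rule combination_in_lat)
  have "r \<in> box T" unfolding r_def box_def using T by (intro imageI) auto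
  moreover have "r / of_nat T \<in> B" using B(2)[OF x, of q] q B(1) x_eq by auto
  ultimately have "r / of_nat T \<in> B'" using trace by blast
  moreover have "q \<in> B'" using q B'(1) by blast
  ultimately show "x \<in> B'" unfolding x_eq by (intro B'(2))
qed

text \<open>The \<open>n\<close>-th power of the ideal \<open>(a, b)\<close>, multiplied by
  \<open>lat\<close>. As \<open>lat\<close> may lack 1, the monomials themselves need not be
  members.\<close>

definition power_module :: "'k \<Rightarrow> 'k \<Rightarrow> nat \<Rightarrow> 'k set" where
  "power_module a b n = {\<Sum>s\<le>n. a ^ s * b ^ (n - s) * l s | l. \<forall>s. l s \<in> lat}"

lemma power_moduleI:
  "x = (\<Sum>s\<le>n. a ^ s * b ^ (n - s) * l s) \<Longrightarrow> (\<And>s. l s \<in> lat) \<Longrightarrow> x \<in> power_module a b n"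
  unfolding power_module_def by auto

lemma power_module_closed:
  assumes "x \<in> power_module a b n" "y \<in> power_module a b n" "l \<in> lat"
  shows "of_nat t * x - l * y \<in> power_module a b n" "x + y \<in> power_module a b n"
    "x - y \<in> power_module a b n" "y * l \<in> power_module a b n"
proof -
  obtain u v where u: "x = (\<Sum>s\<le>n. a ^ s * b ^ (n - s) * u s)" "\<forall>s. u s \<in> lat"
    and v: "y = (\<Sum>s\<le>n. a ^ s * b ^ (n - s) * v s)" "\<forall>s. v s \<in> lat"
    using assms(1,2) unfolding power_module_def by blast
  have "of_nat t * x - l * y = (\<Sum>s\<le>n. a ^ s * b ^ (n - s) * (of_nat t * u s - l * v s))"
    by (simp add: u(1) v(1) sum_distrib_left sum_subtractf algebra_simps)
  then show "of_nat t * x - l * y \<in> power_module a b n"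
    by (rule power_moduleI) (simp add: u(2) v(2) assms(3) lat_closed lat_mult_closed)
  have "x + y = (\<Sum>s\<le>n. a ^ s * b ^ (n - s) * (u s + v s))"
    by (simp add: u(1) v(1) sum.distrib distrib_left)
  then show "x + y \<in> power_module a b n"
    by (rule power_moduleI) (simp add: u(2) v(2) assms(3) lat_closed lat_mult_closed)
  have "x - y = (\<Sum>s\<le>n. a ^ s * b ^ (n - s) * (u s - v s))"
    by (simp add: u(1) v(1) sum_subtractf right_diff_distrib)
  then show "x - y \<in> power_module a b n"
    by (rule power_moduleI) (simp add: u(2) v(2) assms(3) lat_closed lat_mult_closed)
  have "y * l = (\<Sum>s\<le>n. a ^ s * b ^ (n - s) * (v s * l))"
    by (simp add: v(1) sum_distrib_right mult.assoc)
  then show "y * l \<in> power_module a b n"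
    by (rule power_moduleI) (simp add: u(2) v(2) assms(3) lat_closed lat_mult_closed)
qed

lemma power_module_monomial:
  assumes "s \<le> n" "l \<in> lat"
  shows "a ^ s * b ^ (n - s) * l \<in> power_module a b n"
proof -
  have "a ^ s * b ^ (n - s) * l = (\<Sum>r\<le>n. a ^ r * b ^ (n - r) * (if r = s then l else 0))"
    using assms(1) by (simp add: if_distrib[of "\<lambda>x. _ * x"] cong: if_cong)
  then show ?thesis by (rule power_moduleI) (simp add: assms(2) lat_closed)
qed

lemma power_module_denominator: "\<exists>D > 0. \<forall>x\<in>power_module a b n. of_nat D * x \<in> lat"
proof -
  have "\<forall>s. \<exists>D > 0. of_nat D * (a ^ s * b ^ (n - s)) \<in> lat"
    by (intro allI exists_denominator)
  then obtain D where D: "\<And>s. D s > (0 :: nat)" "\<And>s. of_nat (D s) * (a ^ s * b ^ (n - s)) \<in> lat"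
    by metis
  define E where "E = (\<Prod>s\<le>n. D s)"
  have E: "of_nat E * (a ^ s * b ^ (n - s)) \<in> lat" if "s \<le> n" for s
  proof -
    have "D s dvd E" unfolding E_def using that by (intro dvd_prodI) auto
    then obtain k where "E = D s * k" by blast
    then have eq: "of_nat E * (a ^ s * b ^ (n - s)) = of_nat k * (of_nat (D s) * (a ^ s * b ^ (n - s)))"
      by simp
    show ?thesis unfolding eq by (rule lat_closed(4)[OF D(2)])
  qed
  have "of_nat E * x \<in> lat" if x: "x \<in> power_module a b n" for x
  proof -
    obtain u where u: "x = (\<Sum>s\<le>n. a ^ s * b ^ (n - s) * u s)" "\<forall>s. u s \<in> lat"
      using x unfolding power_module_def by blast
    have "of_nat E * x = (\<Sum>s\<le>n. of_nat E * (a ^ s * b ^ (n - s)) * u s)"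
      by (simp add: u(1) sum_distrib_left mult.assoc)
    also have "\<dots> \<in> lat" by (intro lat_sum lat_mult_closed E) (use u(2) in auto)
    finally show ?thesis .
  qed
  moreover have "E > 0" unfolding E_def using D(1) by (simp add: prod_pos)
  ultimately show ?thesis by blast
qed

text \<open>Finiteness of the ideal class group, for the classes of the powers of one ideal.\<close>

lemma power_module_classes_repeat:
  assumes "b \<noteq> 0"
  shows "\<exists>i j c. i < j \<and> c \<noteq> 0 \<and> power_module a b j = (*) c ` power_module a b i"
proof -
  obtain T where T: "T > 0" and gen: "\<And>A. fractional_module A \<Longrightarrow>
      \<exists>b\<in>A. b \<noteq> 0 \<and> (\<forall>x\<in>A. \<exists>l\<in>lat. of_nat T * x = b * l)"
    using almost_principal by auto
  let ?P = "power_module a b"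
  have "\<exists>c\<in>?P n. c \<noteq> 0 \<and> (\<forall>x\<in>?P n. \<exists>l\<in>lat. of_nat T * x = c * l)" for n
  proof (rule gen, unfold fractional_module_def, intro conjI)
    obtain D where "D > 0" "of_nat D * 1 \<in> lat" using exists_denominator by blast
    then show "\<exists>x\<in>?P n. x \<noteq> 0"
      using power_module_monomial[of 0 n "of_nat D * 1" a b] assms
      by (intro bexI[of _ "b ^ n * of_nat D"]) auto
  qed (use power_module_denominator power_module_closed(1) in auto)
  then obtain c where c: "\<And>n. c n \<in> ?P n" "\<And>n. c n \<noteq> 0"
      "\<And>n x. x \<in> ?P n \<Longrightarrow> \<exists>l\<in>lat. of_nat T * x = c n * l"
    by metis
  \<comment> \<open>The normalised modules \<open>P n / c n\<close> all lie between
    \<open>lat\<close> and \<open>lat / T\<close>: they contain \<open>lat\<close> because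
    \<open>c n\<close> lies in \<open>P n\<close>. Hence two of them coincide.\<close>
  define B where "B n = {x. c n * x \<in> ?P n}" for n
  define tr where "tr n = {x \<in> box T. x / of_nat T \<in> B n}" for n
  have "tr ` UNIV \<subseteq> Pow (box T)" by (auto simp: tr_def)
  then have "finite (range tr)" using finite_box finite_subset by blast
  then have "\<not> inj tr" using finite_imageD by blast
  then obtain i j where ij: "i < j" "tr i = tr j" unfolding inj_on_def
    by (metis linorder_neqE_nat)
  have B: "lat \<subseteq> B n" "x \<in> B n \<Longrightarrow> y \<in> B n \<Longrightarrow> x - y \<in> B n" "x \<in> B n \<Longrightarrow> y \<in> B n \<Longrightarrow> x + y \<in> B n"
    "x \<in> B n \<Longrightarrow> of_nat T * x \<in> lat" for n x y
  proof -
    show "lat \<subseteq> B n" using power_module_closed(4)[OF c(1) c(1)] by (auto simp: B_def)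
    show "x - y \<in> B n" if "x \<in> B n" "y \<in> B n"
      using that power_module_closed(3)[OF _ _ lat_closed(1)] by (auto simp: B_def right_diff_distrib)
    show "x + y \<in> B n" if "x \<in> B n" "y \<in> B n"
      using that power_module_closed(2)[OF _ _ lat_closed(1)] by (auto simp: B_def distrib_left)
    show "of_nat T * x \<in> lat" if x: "x \<in> B n"
    proof -
      obtain l where "l \<in> lat" "of_nat T * (c n * x) = c n * l" 
        using c(3)[of "c n * x" n] x unfolding B_def by blast
      then show ?thesis using c(2)[of n] by (simp add: mult.left_commute)
    qed
  qed
  have sub: "B i \<subseteq> B j" if "tr i \<subseteq> tr j" for i j
    by (rule lattice_trace_mono[OF T B(1) B(2) B(4) B(1) B(3) that[unfolded tr_def]])
  have "B i = B j" using sub[of i j] sub[of j i] ij(2) by blast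
  then have eq: "c i * x \<in> ?P i \<longleftrightarrow> c j * x \<in> ?P j" for x unfolding B_def by blast
  have "?P j = (*) (c j / c i) ` ?P i"
  proof (intro equalityI subsetI)
    fix x assume "x \<in> ?P j"
    then have "c i * (x / c j) \<in> ?P i" using eq[of "x / c j"] c(2)[of j] by simp
    then show "x \<in> (*) (c j / c i) ` ?P i"
      using c(2)[of i] c(2)[of j] by (intro image_eqI[of _ _ "c i * (x / c j)"]) auto
  next
    fix x assume "x \<in> (*) (c j / c i) ` ?P i"
    then obtain y where y: "y \<in> ?P i" "x = c j / c i * y" by blast
    then show "x \<in> ?P j" using eq[of "y / c i"] c(2)[of i] by simp
  qed
  moreover have "c j / c i \<noteq> 0" using c(2) by simp
  ultimately show ?thesis using ij(1) by blast
qed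

end

section \<open>Greatest common divisors of algebraic integers\<close>

context integral_coordinates
begin

lemma basis_nonempty: "I \<noteq> {}" and basis_nonzero: "i \<in> I \<Longrightarrow> w i \<noteq> 0"
proof -
  show "I \<noteq> {}" using co_expand[of 1] by auto
  show "w i \<noteq> 0" if "i \<in> I" using co_w[OF that that] by (auto simp: co_zero)
qed

text \<open>A finite generating set over the integers, as required by the stability criterion and by
  the elimination.\<close>

definition power_generators :: "'k \<Rightarrow> 'k \<Rightarrow> nat \<Rightarrow> 'k set" where
  "power_generators a b n = (\<lambda>(s, i). a ^ s * b ^ (n - s) * w i) ` ({..n} \<times> I)"

lemma finite_power_generators: "finite (power_generators a b n)"
  by (simp add: power_generators_def finite_I)

lemma lat_in_zspan: "x \<in> lat \<Longrightarrow> x \<in> zspan (w ` I)"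
proof -
  assume "x \<in> lat"
  then have "\<forall>i\<in>I. \<exists>c. co x i = of_int c" by (auto simp: lat_def elim: Ints_cases)
  then obtain c where c: "\<And>i. i \<in> I \<Longrightarrow> co x i = of_int (c i)" by metis
  have "x = (\<Sum>i\<in>I. of_int (c i) * w i)"
    by (rule co_eqI) (simp only: c co_int_combination)
  also have "\<dots> \<in> zspan (w ` I)"
    by (intro zmod.span_sum zmod.span_scale zmod.span_base) auto
  finally show ?thesis .
qed

lemma power_monomial_in_zspan:
  assumes "s \<le> n" "l \<in> lat"
  shows "a ^ s * b ^ (n - s) * l \<in> zspan (power_generators a b n)"
proof (rule zmod.span_mult_closed[OF _ lat_in_zspan[OF assms(2)]])
  fix x assume "x \<in> w ` I"
  then show "a ^ s * b ^ (n - s) * x \<in> zspan (power_generators a b n)"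
    using assms(1) unfolding power_generators_def
    by (intro zmod.span_base) auto
qed

lemma power_module_zspan: "x \<in> power_module a b n \<Longrightarrow> x \<in> zspan (power_generators a b n)"
  unfolding power_module_def by (auto intro!: zmod.span_sum power_monomial_in_zspan)

lemma power_generators_in_module: "x \<in> power_generators a b n \<Longrightarrow> x \<in> power_module a b n"
  unfolding power_generators_def by (auto intro!: power_module_monomial lat_closed)

lemma power_module_mult:
  assumes "x \<in> power_module a b n" "r \<le> m"
  shows "a ^ r * b ^ (m - r) * x \<in> power_module a b (m + n)"
proof -
  obtain l where l: "x = (\<Sum>s\<le>n. a ^ s * b ^ (n - s) * l s)" "\<forall>s. l s \<in> lat"
    using assms(1) unfolding power_module_def by blast
  have zero: "0 \<in> power_module a b (m + n)"
    using power_module_monomial[of 0 "m + n" 0 a b] lat_closed(1) by simp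
  have "a ^ r * b ^ (m - r) * x = (\<Sum>s\<le>n. a ^ (r + s) * b ^ (m + n - (r + s)) * l s)"
    unfolding l(1) sum_distrib_left
  proof (rule sum.cong[OF refl])
    fix s assume "s \<in> {..n}"
    then have "m + n - (r + s) = (m - r) + (n - s)" using assms(2) by simp
    then show "a ^ r * b ^ (m - r) * (a ^ s * b ^ (n - s) * l s) = a ^ (r + s) * b ^ (m + n - (r + s)) * l s"
      by (simp add: power_add mult_ac)
  qed
  moreover have "(\<Sum>s\<in>J. a ^ (r + s) * b ^ (m + n - (r + s)) * l s) \<in> power_module a b (m + n)"
    if "finite J" "J \<subseteq> {..n}" for J
    using that
  proof (induction J rule: finite_induct)
    case (insert s J)
    have "a ^ (r + s) * b ^ (m + n - (r + s)) * l s \<in> power_module a b (m + n)"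
      using insert.prems assms(2) l(2) by (intro power_module_monomial) auto
    then show ?case using insert power_module_closed(2)[OF _ _ lat_closed(1)] by simp
  qed (simp add: zero)
  ultimately show ?thesis by simp
qed

text \<open>If the \<open>m\<close>-th power of the ideal \<open>(a, b)\<close> is equivalent to the unit ideal, an \<open>m\<close>-th root
  of its generator generates the extension of the ideal \<open>(a, b)\<close>.\<close>

lemma bezout_cofactors:
  fixes a b :: 'k
  assumes "b \<noteq> 0"
  shows "\<exists>d p q x y. d \<noteq> 0 \<and> to_ac a = d * p \<and> to_ac b = d * q \<and> x * p + y * q = 1 \<and>
    algebraic_int p \<and> algebraic_int q \<and> algebraic_int x \<and> algebraic_int y"
proof -
  obtain i j c where ij: "i < j" "c \<noteq> 0" "power_module a b j = (*) c ` power_module a b i"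
    using power_module_classes_repeat[OF assms, where a = a] by (elim exE conjE)
  define m where "m = j - i"
  have m: "m > 0" "j = m + i" using ij(1) by (auto simp: m_def)
  \<comment> \<open>Formally the \<open>m\<close>-th power of \<open>(a, b)\<close> is generated by
    \<open>c\<close>, so its \<open>m\<close>-th root \<open>d\<close> should generate
    \<open>(a, b)\<close>.\<close>
  obtain d where d: "d ^ m = to_ac c" using nth_root_exists[OF m(1)] by blast
  have d0: "d \<noteq> 0" using d m(1) ij(2) by (auto simp: power_0_left)
  define p where "p = to_ac a / d"
  define q where "q = to_ac b / d"
  let ?S = "power_generators a b i"
  obtain l0 where l0: "l0 \<in> I" using basis_nonempty by blast
  define s0 where "s0 = b ^ i * w l0"
  have s0: "s0 \<in> ?S" "s0 \<noteq> 0"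
    using l0 assms basis_nonzero[OF l0] unfolding s0_def power_generators_def
    by (auto intro!: image_eqI[of _ _ "(0, l0)"])
  \<comment> \<open>Multiplication by a monomial of degree \<open>m\<close> maps
    \<open>power_module a b i\<close> into \<open>power_module a b j\<close>, which is
    \<open>c\<close> times the former. So the quotient by \<open>c\<close> stabilises a finitely
    generated group. The cases \<open>r = m\<close> and \<open>r = 0\<close> give
    \<open>p ^ m\<close> and \<open>q ^ m\<close>.\<close>
  have integral: "algebraic_int (a ^ r * b ^ (m - r) / c)" if "r \<le> m" for r
  proof (rule algebraic_intI_stable[OF finite_power_generators s0])
    fix s assume "s \<in> ?S"
    then have "a ^ r * b ^ (m - r) * s \<in> power_module a b j"
      unfolding m(2) by (intro power_module_mult power_generators_in_module that)
    then have "a ^ r * b ^ (m - r) * s \<in> (*) c ` power_module a b i"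
      by (simp only: ij(3))
    then obtain t where t: "t \<in> power_module a b i" "a ^ r * b ^ (m - r) * s = c * t" by blast
    then have "a ^ r * b ^ (m - r) / c * s = t" using ij(2) by (simp add: field_simps)
    then show "a ^ r * b ^ (m - r) / c * s \<in> zspan ?S" using power_module_zspan t(1) by simp
  qed
  have "p ^ m = to_ac (a ^ m / c)" "q ^ m = to_ac (b ^ m / c)"
    by (simp_all add: p_def q_def power_divide d)
  moreover have "algebraic_int (a ^ m / c)" "algebraic_int (b ^ m / c)"
    using integral[of m] integral[of 0] by simp_all
  ultimately have "algebraic_int (p ^ m)" "algebraic_int (q ^ m)"
    by (simp_all only: algebraic_int_to_ac)
  then have pq: "algebraic_int p" "algebraic_int q"
    using algebraic_int_root_power[OF m(1)] by blast+
  \<comment> \<open>The ideal of \<open>p\<close> and \<open>q\<close> in the ring of all algebraic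
    integers; it remains to show that it contains 1.\<close>
  define J where "J = {x * p + y * q | x y. algebraic_int x \<and> algebraic_int y}"
  have J_add: "u + v \<in> J" if uv: "u \<in> J" "v \<in> J" for u v
  proof -
    obtain x y x' y' where "u = x * p + y * q" "v = x' * p + y' * q"
      and i: "algebraic_int x" "algebraic_int y" "algebraic_int x'" "algebraic_int y'"
      using uv unfolding J_def by blast
    then have "u + v = (x + x') * p + (y + y') * q" by (simp add: algebra_simps)
    then show ?thesis unfolding J_def using i by blast
  qed
  have J_mult: "u * v \<in> J" if uv: "algebraic_int u" "v \<in> J" for u v
  proof -
    obtain x y where "v = x * p + y * q" and i: "algebraic_int x" "algebraic_int y"
      using uv unfolding J_def by blast
    then have "u * v = (u * x) * p + (u * y) * q" by (simp add: algebra_simps)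
    then show ?thesis unfolding J_def using i uv(1) by blast
  qed
  have J_int: "algebraic_int v" if "v \<in> J" for v
    using that pq unfolding J_def by blast
  have J_zero: "0 \<in> J" unfolding J_def by (rule CollectI, rule exI[of _ 0], rule exI[of _ 0]) simp
  have "p \<in> J" unfolding J_def by (rule CollectI, rule exI[of _ 1], rule exI[of _ 0]) simp
  have "q \<in> J" unfolding J_def by (rule CollectI, rule exI[of _ 0], rule exI[of _ 1]) simp
  have J_pow: "p ^ r * q ^ (m - r) \<in> J" if "r \<le> m" for r
  proof (cases r)
    case 0
    then have eq: "p ^ r * q ^ (m - r) = q ^ (m - 1) * q" using m(1) by (simp flip: power_Suc2)
    show ?thesis unfolding eq by (intro J_mult algebraic_int_pow pq \<open>q \<in> J\<close>)
  next
    case (Suc k)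
    have "algebraic_int (p ^ k * q ^ (m - r))" using pq by blast
    moreover have eq: "p ^ r * q ^ (m - r) = p ^ k * q ^ (m - r) * p" using Suc by simp
    ultimately show ?thesis unfolding eq by (intro J_mult \<open>p \<in> J\<close>)
  qed
  \<comment> \<open>The extension of \<open>power_module a b i\<close> multiplied by
    \<open>J\<close>. The elimination applies once every generator is seen to lie in it.\<close>
  define JS where "JS = {\<Sum>t\<in>?S. f t * to_ac t | f. \<forall>t\<in>?S. f t \<in> J}"
  have JS_add: "u + v \<in> JS" if uv: "u \<in> JS" "v \<in> JS" for u v
  proof -
    obtain f g where "u = (\<Sum>t\<in>?S. f t * to_ac t)" "v = (\<Sum>t\<in>?S. g t * to_ac t)"
      and fg: "\<forall>t\<in>?S. f t \<in> J" "\<forall>t\<in>?S. g t \<in> J" using uv unfolding JS_def by blast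
    then have "u + v = (\<Sum>t\<in>?S. (f t + g t) * to_ac t)" by (simp add: sum.distrib distrib_right)
    then show ?thesis unfolding JS_def using fg J_add
      by (intro CollectI exI[of _ "\<lambda>t. f t + g t"]) auto
  qed
  have JS_zero: "0 \<in> JS" unfolding JS_def using J_zero by (intro CollectI exI[of _ "\<lambda>_. 0"]) auto
  have JS_mult: "u * to_ac x \<in> JS" if ux: "u \<in> J" "x \<in> zspan ?S" for u x
  proof -
    obtain f where "x = (\<Sum>t\<in>?S. of_int (f t) * t)"
      using ux(2) unfolding zmod.span_finite[OF finite_power_generators] by blast
    then have "u * to_ac x = (\<Sum>t\<in>?S. (of_int (f t) * u) * to_ac t)"
      by (simp add: to_ac_sum sum_distrib_left mult_ac)
    then show ?thesis unfolding JS_def using J_mult ux(1)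
      by (intro CollectI exI[of _ "\<lambda>t. of_int (f t) * u"]) auto
  qed
  have key: "to_ac s \<in> JS" if "s \<in> ?S" for s
  proof -
    \<comment> \<open>Every monomial of degree \<open>j = m + i\<close> splits into one of degree
      \<open>m\<close> and one of degree \<open>i\<close>. Division by \<open>c\<close>, that is by
      \<open>d ^ m\<close>, turns the former into a monomial of degree \<open>m\<close> in
      \<open>p\<close> and \<open>q\<close>, which lies in \<open>J\<close> since
      \<open>m > 0\<close>.\<close>
    have "c * s \<in> power_module a b j"
      using power_generators_in_module[OF that] ij(3) by blast
    then obtain l where l: "c * s = (\<Sum>r\<le>j. a ^ r * b ^ (j - r) * l r)" "\<forall>r. l r \<in> lat"
      unfolding power_module_def by blast
    have summand: "to_ac (a ^ r * b ^ (j - r) * l r) / d ^ m \<in> JS" if "r \<le> j" for r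
    proof -
      \<comment> \<open>As many factors \<open>a\<close> as possible go into the part of degree
        \<open>m\<close>; this leaves at most \<open>i\<close> of them for the other part.\<close>
      define r1 where "r1 = min r m"
      define r2 where "r2 = r - r1"
      have r: "r1 \<le> m" "r2 \<le> i" "r = r1 + r2" "j - r = (m - r1) + (i - r2)"
        using that m(2) by (auto simp: r1_def r2_def min_def)
      have "to_ac (a ^ r * b ^ (j - r) * l r) / d ^ m =
          (to_ac a ^ r1 * to_ac b ^ (m - r1)) / d ^ m * to_ac (a ^ r2 * b ^ (i - r2) * l r)"
        unfolding r(4) by (subst r(3)) (simp add: power_add mult_ac)
      also have "(to_ac a ^ r1 * to_ac b ^ (m - r1)) / d ^ m = p ^ r1 * q ^ (m - r1)"
      proof -
        have "d ^ m = d ^ r1 * d ^ (m - r1)" using r(1) by (simp flip: power_add)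
        then show ?thesis by (simp add: p_def q_def power_divide)
      qed
      also have "p ^ r1 * q ^ (m - r1) * to_ac (a ^ r2 * b ^ (i - r2) * l r) \<in> JS"
        using l(2) by (intro JS_mult J_pow r(1) power_monomial_in_zspan r(2)) auto
      finally show ?thesis .
    qed
    have "to_ac s = to_ac (c * s) / d ^ m" using ij(2) by (simp add: d)
    also have "\<dots> = (\<Sum>r\<le>j. to_ac (a ^ r * b ^ (j - r) * l r) / d ^ m)"
      unfolding l(1) by (simp only: to_ac_sum sum_divide_distrib)
    also have "\<dots> \<in> JS"
    proof -
      have "(\<Sum>r\<in>R. to_ac (a ^ r * b ^ (j - r) * l r) / d ^ m) \<in> JS" if "finite R" "R \<subseteq> {..j}" for R
        using that by (induction R rule: finite_induct) (simp_all add: JS_zero JS_add summand del: to_ac_mult to_ac_power)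
      then show ?thesis by blast
    qed
    finally show ?thesis .
  qed
  then have "\<forall>s\<in>?S. \<exists>f. to_ac s = (\<Sum>t\<in>?S. f t * to_ac t) \<and> (\<forall>t\<in>?S. f t \<in> J)"
    unfolding JS_def by blast
  then obtain f where f: "\<And>s. s \<in> ?S \<Longrightarrow> to_ac s = (\<Sum>t\<in>?S. f s t * to_ac t)"
    "\<And>s t. s \<in> ?S \<Longrightarrow> t \<in> ?S \<Longrightarrow> f s t \<in> J" by metis
  have J_diff: "u - v \<in> J" if "u \<in> J" "v \<in> J" for u v
    using J_add[OF that(1) J_mult[OF _ that(2), of "- 1"]] by simp
  have J_times: "u * v \<in> J" if "u \<in> J" "v \<in> J" for u v
    using J_mult[OF J_int[OF that(1)] that(2)] .
  have nz: "to_ac s0 \<noteq> 0" using s0(2) by simp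
  have "1 \<in> J"
    by (rule nakayama_elimination[where v = to_ac and c = f,
        OF J_zero J_add J_diff J_times finite_power_generators f(2,1) s0(1) nz])
  then obtain x y where "1 = x * p + y * q" "algebraic_int x" "algebraic_int y"
    unfolding J_def by blast
  moreover have "to_ac a = d * p" "to_ac b = d * q" using d0 by (auto simp: p_def q_def)
  ultimately show ?thesis using d0 pq by metis
qed

end

lemma algebraic_int_bezout:
  assumes "number_field TYPE('k :: field_char_0)" "(b :: 'k) \<noteq> 0"
  shows "\<exists>d p q x y. d \<noteq> 0 \<and> to_ac a = d * p \<and> to_ac b = d * q \<and> x * p + y * q = 1 \<and>
    algebraic_int p \<and> algebraic_int q \<and> algebraic_int x \<and> algebraic_int y"
proof -
  obtain I :: "'k set" and w :: "'k \<Rightarrow> 'k" and co where "integral_coordinates I w co"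
    using number_field_coordinates[OF assms(1)] by blast
  then show ?thesis by (rule integral_coordinates.bezout_cofactors[OF _ assms(2)])
qed

section \<open>Divisors in residue classes\<close>

text \<open>The group generated by the powers of \<open>g\<close> is finitely generated, hence
  finite modulo \<open>N\<close>, and two powers of \<open>g\<close> must agree there.\<close>

lemma powers_congruent:
  fixes g :: "'a :: field_char_0"
  assumes g: "algebraic_int g" and N: "N > 0"
  shows "\<exists>i j z. i < j \<and> algebraic_int z \<and> g ^ j - g ^ i = of_nat N * z"
proof -
  obtain p where p: "lead_coeff p = 1" "\<forall>i. Polynomial.coeff p i \<in> \<int>" "poly p g = 0"
    using g by (auto simp: algebraic_int.simps)
  define n where "n = Polynomial.degree p"
  have n: "n > 0" unfolding n_def by (rule monic_root_degree_pos[OF p(1,3)])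
  define S where "S = (\<lambda>i. g ^ i) ` {..<n}"
  have fin: "finite S" by (simp add: S_def)
  have S_int: "algebraic_int s" if "s \<in> S" for s using that g by (auto simp: S_def)
  have stable: "g * s \<in> zspan S" if s: "s \<in> S" for s
  proof -
    obtain i where i: "i < n" "s = g ^ i" using s by (auto simp: S_def)
    show ?thesis
    proof (cases "Suc i < n")
      case True
      then have "g ^ Suc i \<in> S" unfolding S_def by blast
      then show ?thesis using i(2) zmod.span_base by auto
    next
      case False
      then have "n = Suc i" using i(1) by simp
      then have "g * s = (\<Sum>i<n. (- Polynomial.coeff p i) * g ^ i)"
        using monic_root_power[OF p(1,3)] i(2) unfolding n_def by simp
      also have "\<dots> \<in> zspan S"
      proof (rule zmod.span_sum)
        fix k assume "k \<in> {..<n}"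
        then have "g ^ k \<in> zspan S" unfolding S_def by (intro zmod.span_base imageI)
        moreover obtain c where "- Polynomial.coeff p k = of_int c"
          using p(2) by (metis Ints_cases Ints_minus)
        ultimately show "- Polynomial.coeff p k * g ^ k \<in> zspan S"
          by (simp only: zmod.span_scale)
      qed
      finally show ?thesis .
    qed
  qed
  have pow: "g ^ k \<in> zspan S" for k
  proof (induction k)
    case 0
    have "g ^ 0 \<in> S" unfolding S_def using n by blast
    then show ?case by (rule zmod.span_base)
  next
    case (Suc k)
    then show ?case using zmod.span_mult_closed[OF stable] by simp
  qed
  have "\<forall>k. \<exists>u. g ^ k = (\<Sum>s\<in>S. of_int (u s) * s)"
    using pow unfolding zmod.span_finite[OF fin] by blast
  then obtain u where u: "\<And>k. g ^ k = (\<Sum>s\<in>S. of_int (u k s) * s)" by metis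
  define F where "F k = (\<lambda>s\<in>S. u k s mod int N)" for k
  have "range F \<subseteq> S \<rightarrow>\<^sub>E {0..<int N}" using N by (auto simp: F_def)
  moreover have "finite (S \<rightarrow>\<^sub>E {0..<int N})" by (intro finite_PiE fin) simp
  ultimately have "finite (range F)" by (rule finite_subset)
  then have "\<not> inj F" using finite_imageD by blast
  then obtain i j where ij: "i < j" "F i = F j" unfolding inj_on_def
    by (metis linorder_neqE_nat)
  define z where "z = (\<Sum>s\<in>S. of_int ((u j s - u i s) div int N) * s)"
  have "of_int (u j s) * s - of_int (u i s) * s = of_nat N * (of_int ((u j s - u i s) div int N) * s)"
    if "s \<in> S" for s
  proof -
    have "u j s mod int N = u i s mod int N" using fun_cong[OF ij(2), of s] that by (simp add: F_def)
    then have "int N * ((u j s - u i s) div int N) = u j s - u i s"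
      by (simp add: mod_eq_dvd_iff)
    then have "of_int (u j s) - of_int (u i s) = (of_int (int N * ((u j s - u i s) div int N)) :: 'a)"
      by simp
    then show ?thesis by (simp only: of_int_mult of_int_of_nat_eq mult.assoc left_diff_distrib[symmetric])
  qed
  then have "g ^ j - g ^ i = of_nat N * z"
    unfolding z_def sum_distrib_left u[of i] u[of j] sum_subtractf[symmetric] by (rule sum.cong[OF refl])
  moreover have "algebraic_int z" unfolding z_def using S_int by (intro algebraic_int_sum algebraic_int_times) auto
  ultimately show ?thesis using ij(1) by blast
qed

section \<open>Units congruent to a given invertible residue\<close>

lemma comaximal_power:
  fixes g h :: "'a :: field_char_0"
  assumes "x * g + y * h = 1" "algebraic_int x" "algebraic_int y" "algebraic_int g" "algebraic_int h"
  shows "\<exists>x y. x * g ^ n + y * h = 1 \<and> algebraic_int x \<and> algebraic_int y"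
proof (induction n)
  case 0
  show ?case by (intro exI[of _ 1] exI[of _ 0]) simp
next
  case (Suc n)
  then obtain x' y' where xy: "x' * g ^ n + y' * h = 1" "algebraic_int x'" "algebraic_int y'" by blast
  have "(x' * x) * g ^ Suc n + (x' * g ^ n * y + y') * h = x' * g ^ n * (x * g + y * h) + y' * h"
    by (simp add: algebra_simps)
  also have "\<dots> = 1" using assms(1) xy(1) by simp
  finally have "(x' * x) * g ^ Suc n + (x' * g ^ n * y + y') * h = 1" .
  moreover have "algebraic_int (x' * x)" "algebraic_int (x' * g ^ n * y + y')" using xy assms by blast+
  ultimately show ?case by metis
qed

lemma power_add_diff:
  fixes u :: "'a :: field_char_0"
  assumes "algebraic_int u" "algebraic_int t"
  shows "\<exists>r. algebraic_int r \<and> (u + t) ^ n - t ^ n = u * r"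
proof (induction n)
  case 0
  show ?case by (intro exI[of _ 0]) simp
next
  case (Suc n)
  then obtain r where r: "algebraic_int r" "(u + t) ^ n - t ^ n = u * r" by blast
  have "(u + t) ^ Suc n - t ^ Suc n = (u + t) * ((u + t) ^ n - t ^ n) + u * t ^ n"
    by (simp add: algebra_simps)
  also have "\<dots> = u * ((u + t) * r + t ^ n)" unfolding r(2) by (simp add: algebra_simps)
  finally have "(u + t) ^ Suc n - t ^ Suc n = u * ((u + t) * r + t ^ n)" .
  moreover have "algebraic_int ((u + t) * r + t ^ n)" using r(1) assms by blast
  ultimately show ?case by metis
qed

lemma algebraic_int_trinomial_root:
  fixes c e :: "'a :: {field_char_0, alg_closed_field}"
  assumes "n > 1" "algebraic_int c" "algebraic_int e"
  shows "\<exists>v. algebraic_int v \<and> v ^ n + c * v ^ (n - 1) + e = 0"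
proof -
  define f where "f k = (if k = n then 1 else 0) + (if k = n - 1 then c else 0) + (if k = 0 then e else 0)" for k
  have fn: "f n = 1" using assms(1) by (simp add: f_def)
  obtain v where v: "(\<Sum>k\<le>n. f k * v ^ k) = 0"
    using alg_closed[of n f] fn assms(1) by auto
  have "(\<Sum>k\<le>n. f k * v ^ k) = (\<Sum>k\<le>n. if k = n then v ^ k else 0) + (\<Sum>k\<le>n. if k = n - 1 then c * v ^ k else 0)
      + (\<Sum>k\<le>n. if k = 0 then e * v ^ k else 0)"
    unfolding sum.distrib[symmetric] f_def by (rule sum.cong) (auto simp: distrib_right)
  also have "\<dots> = v ^ n + c * v ^ (n - 1) + e" by simp
  finally have root: "v ^ n + c * v ^ (n - 1) + e = 0" using v by simp
  have "{..n} = insert n {..<n}" by auto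
  then have "v ^ n = (\<Sum>k<n. (- f k) * v ^ k)"
    using v fn by (simp add: sum_negf eq_neg_iff_add_eq_0)
  moreover have "algebraic_int (- f k)" for k unfolding f_def using assms(2,3) by auto
  ultimately have "algebraic_int v" using assms(1) by (intro algebraic_int_integrally_closed[of n v "\<lambda>k. - f k"]) auto
  then show ?thesis using root by blast
qed

text \<open>The polynomial equation of the root \<open>v\<close> makes the norm of \<open>g + h * v\<close> over the
  field of its coefficients equal to 1.\<close>

lemma unit_in_residue_class:
  fixes g h :: "'a :: {field_char_0, alg_closed_field}"
  assumes gh: "algebraic_int g" "algebraic_int h" and xy: "x * g + y * h = 1" "algebraic_int x" "algebraic_int y"
    and N: "of_nat N = h * k" "N > 0" "algebraic_int k"
  shows "\<exists>v. algebraic_int v \<and> g + h * v \<noteq> 0 \<and> algebraic_int (inverse (g + h * v))"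
proof -
  obtain i j z where ij: "i < j" "algebraic_int z" "g ^ j - g ^ i = of_nat N * z"
    using powers_congruent[OF gh(1) N(2)] by blast
  obtain x1 y1 where x1: "x1 * g ^ i + y1 * h = 1" "algebraic_int x1" "algebraic_int y1"
    using comaximal_power[OF xy gh] by blast
  \<comment> \<open>Modulo \<open>h\<close> the power \<open>g ^ i\<close> is inverted by
    \<open>x1\<close>, and \<open>h\<close> divides \<open>N\<close>. Cancelling it shows that
    \<open>g ^ m\<close> is 1 modulo \<open>h\<close>, with quotient \<open>t\<close>.\<close>
  define m where "m = j - i"
  have m: "m > 0" "g ^ j = g ^ i * g ^ m" using ij(1) by (auto simp: m_def simp flip: power_add)
  define t where "t = x1 * k * z + y1 * (g ^ m - 1)"
  have t_int: "algebraic_int t" unfolding t_def using x1 N(3) ij(2) gh(1) by blast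
  have "g ^ m - 1 = (x1 * g ^ i + y1 * h) * (g ^ m - 1)" by (simp add: x1(1))
  also have "\<dots> = x1 * (g ^ j - g ^ i) + h * (y1 * (g ^ m - 1))" by (simp add: m(2) algebra_simps)
  also have "\<dots> = h * t" unfolding ij(3) N(1) t_def by (simp add: algebra_simps)
  finally have gm: "g ^ m = 1 + h * t" by (simp add: algebra_simps)
  \<comment> \<open>An even exponent makes \<open>(- g) ^ n\<close> again 1 modulo \<open>h\<close>
    and fixes the sign of the odd power \<open>(- g) ^ (n - 1)\<close>.\<close>
  define n where "n = 2 * m"
  define s where "s = 2 * t + h * t ^ 2"
  have s_int: "algebraic_int s" unfolding s_def using t_int gh by blast
  have n: "n > 1" "even n" using m(1) by (auto simp: n_def)
  have "g ^ n = (g ^ m) ^ 2" by (simp add: n_def mult.commute flip: power_mult)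
  also have "\<dots> = 1 + h * s" unfolding gm s_def by (simp add: power2_eq_square algebra_simps)
  finally have gn: "(- g) ^ n = 1 + h * s" using n(2) by simp
  obtain x2 y2 where x2: "x2 * g ^ (n - 1) + y2 * h = 1" "algebraic_int x2" "algebraic_int y2"
    using comaximal_power[OF xy gh] by blast
  \<comment> \<open>With the roles of the two elements exchanged, comaximality passes to powers of
    \<open>h\<close> as well.\<close>
  have "y2 * h + x2 * g ^ (n - 1) = 1" using x2(1) by (simp add: add.commute)
  then obtain x3 y3 where x3: "x3 * h ^ (n - 1) + y3 * g ^ (n - 1) = 1" "algebraic_int x3" "algebraic_int y3"
    using comaximal_power[OF _ x2(3,2) gh(2) algebraic_int_pow[OF gh(1)]] by blast
  \<comment> \<open>\<open>c\<close> and \<open>e\<close> are chosen so that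
    \<open>c * h * (- g) ^ (n - 1) + e * h ^ n\<close> cancels the excess \<open>h * s\<close> of
    \<open>(- g) ^ n\<close> over 1.\<close>
  define c where "c = s * y3"
  define e where "e = - (s * x3)"
  have ce_int: "algebraic_int c" "algebraic_int e" unfolding c_def e_def using s_int x3 by blast+
  obtain v where v: "algebraic_int v" "v ^ n + c * v ^ (n - 1) + e = 0"
    using algebraic_int_trinomial_root[OF n(1) ce_int] by blast
  define u where "u = g + h * v"
  have u_int: "algebraic_int u" unfolding u_def using gh v(1) by blast
  have hn: "h ^ n = h * h ^ (n - 1)" using n(1) by (simp flip: power_Suc)
  have "odd (n - 1)" using n by simp
  then have "c * h * (- g) ^ (n - 1) + e * h ^ n = - h * s * (x3 * h ^ (n - 1) + y3 * g ^ (n - 1))"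
    unfolding hn c_def e_def by (simp add: algebra_simps)
  then have const: "(- g) ^ n + c * h * (- g) ^ (n - 1) + e * h ^ n = 1"
    unfolding gn x3(1) by (simp add: algebra_simps)
  \<comment> \<open>Since \<open>h * v = u - g\<close>, the equation of \<open>v\<close> times
    \<open>h ^ n\<close> is an equation for \<open>u\<close>. Its constant term is the value at
    \<open>u = 0\<close>, which is 1; all other terms are divisible by \<open>u\<close>, so
    \<open>u\<close> is a unit.\<close>
  have "(u + - g) ^ n + c * h * (u + - g) ^ (n - 1) + e * h ^ n = h ^ n * (v ^ n + c * v ^ (n - 1) + e)"
    unfolding u_def hn by (simp add: power_mult_distrib hn algebra_simps)
  then have zero: "(u + - g) ^ n + c * h * (u + - g) ^ (n - 1) + e * h ^ n = 0" unfolding v(2) mult_zero_right .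
  have "algebraic_int (- g)" using gh(1) by simp
  then obtain r1 r2 where r: "algebraic_int r1" "(u + - g) ^ n - (- g) ^ n = u * r1"
    "algebraic_int r2" "(u + - g) ^ (n - 1) - (- g) ^ (n - 1) = u * r2"
    using power_add_diff[OF u_int] by metis
  have "u * (r1 + c * h * r2) = ((u + - g) ^ n - (- g) ^ n) + c * h * ((u + - g) ^ (n - 1) - (- g) ^ (n - 1))"
    unfolding r by (simp add: algebra_simps)
  also have "\<dots> = ((u + - g) ^ n + c * h * (u + - g) ^ (n - 1) + e * h ^ n)
      - ((- g) ^ n + c * h * (- g) ^ (n - 1) + e * h ^ n)"
    by (simp add: right_diff_distrib)
  also have "\<dots> = - 1" unfolding zero const by simp
  finally have unit: "u * (- (r1 + c * h * r2)) = 1" by (simp only: mult_minus_right minus_minus)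
  then have "u \<noteq> 0" "inverse u = - (r1 + c * h * r2)" by (auto simp: inverse_unique)
  moreover have "algebraic_int (- (r1 + c * h * r2))" using r ce_int gh by blast
  ultimately show ?thesis using v(1) unfolding u_def by auto
qed

lemma divisor_in_residue_class:
  assumes k: "number_field TYPE('k :: field_char_0)" and a: "algebraic_int (a :: 'k)" and N: "N > 0"
  shows "\<exists>e. e \<noteq> 0 \<and> algebraic_int e \<and> algebraic_int (of_nat N / e) \<and> algebraic_int ((e - to_ac a) / of_nat N)"
proof -
  have N': "of_nat N \<noteq> (0 :: 'k)" using N by simp
  obtain d p q x y where d: "d \<noteq> 0" "to_ac a = d * p" "to_ac (of_nat N) = d * q" "x * p + y * q = 1"
    "algebraic_int p" "algebraic_int q" "algebraic_int x" "algebraic_int y"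
    using algebraic_int_bezout[OF k N', of a] by (elim exE conjE)
  have Nd: "of_nat N = q * d" using d(3) by (simp add: mult.commute)
  \<comment> \<open>The Bezout relation writes \<open>d\<close> as a combination of integral
    elements; so \<open>N = q * d\<close> exhibits \<open>N\<close> as an integral multiple of
    \<open>q\<close>.\<close>
  have "d = d * (x * p + y * q)" by (simp add: d(4))
  also have "\<dots> = x * to_ac a + y * of_nat N" unfolding d(2) Nd by (simp add: algebra_simps)
  also have "algebraic_int \<dots>" using algebraic_int_to_ac[OF a] d by blast
  finally have d_int: "algebraic_int d" .
  obtain v where v: "algebraic_int v" "p + q * v \<noteq> 0" "algebraic_int (inverse (p + q * v))"
    using unit_in_residue_class[OF d(5,6,4,7,8) Nd N d_int] by blast
  let ?e = "d * (p + q * v)"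
  have "of_nat N / ?e = q * inverse (p + q * v)" 
    unfolding Nd using d(1) by (simp add: divide_inverse)
  moreover have "?e - to_ac a = of_nat N * v" unfolding d(2) Nd by (simp add: algebra_simps)
  then have "(?e - to_ac a) / of_nat N = v" using N by simp
  ultimately show ?thesis using d d_int v by (intro exI[of _ ?e]) auto
qed

section \<open>Finiteness of the residues modulo a positive integer\<close>

definition finite_residues :: "'k :: field_char_0 itself \<Rightarrow> nat \<Rightarrow> bool" where
  "finite_residues _ N \<longleftrightarrow> (\<exists>R :: 'k set. finite R \<and> (\<forall>r\<in>R. algebraic_int r) \<and>
     (\<forall>x. algebraic_int x \<longrightarrow> (\<exists>r\<in>R. algebraic_int ((x - r) / of_nat N))))"

text \<open>Expansion in two digits: a residue \<open>r\<close> modulo \<open>M\<close>, then a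
  residue \<open>s\<close> modulo \<open>N\<close> of the quotient
  \<open>(x - r) / M\<close>.\<close>

lemma finite_residues_mult:
  assumes "finite_residues TYPE('k :: field_char_0) M" "finite_residues TYPE('k) N" "M > 0" "N > 0"
  shows "finite_residues TYPE('k) (M * N)"
proof -
  obtain R1 :: "'k set" where R1: "finite R1" "\<forall>r\<in>R1. algebraic_int r"
    "\<And>x. algebraic_int x \<Longrightarrow> \<exists>r\<in>R1. algebraic_int ((x - r) / of_nat M)"
    using assms(1) unfolding finite_residues_def by blast
  obtain R2 :: "'k set" where R2: "finite R2" "\<forall>r\<in>R2. algebraic_int r"
    "\<And>x. algebraic_int x \<Longrightarrow> \<exists>r\<in>R2. algebraic_int ((x - r) / of_nat N)"
    using assms(2) unfolding finite_residues_def by blast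
  let ?R = "(\<lambda>(r, s). r + of_nat M * s) ` (R1 \<times> R2)"
  have "\<exists>r\<in>?R. algebraic_int ((x - r) / of_nat (M * N))" if x: "algebraic_int x" for x
  proof -
    obtain r where r: "r \<in> R1" "algebraic_int ((x - r) / of_nat M)" using R1(3)[OF x] by blast
    obtain s where s: "s \<in> R2" "algebraic_int (((x - r) / of_nat M - s) / of_nat N)"
      using R2(3)[OF r(2)] by blast
    have "(x - (r + of_nat M * s)) / of_nat (M * N) = ((x - r) / of_nat M - s) / of_nat N"
      using assms(3,4) by (simp add: field_simps)
    then show ?thesis using r(1) s by (intro bexI[of _ "r + of_nat M * s"]) auto
  qed
  moreover have "\<forall>r\<in>?R. algebraic_int r" using R1(2) R2(2) by auto
  moreover have "finite ?R" using R1(1) R2(1) by simp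
  ultimately show ?thesis unfolding finite_residues_def
    by (intro exI[of _ ?R] conjI allI impI)
qed

text \<open>For prime \<open>p\<close>, linear independence over the field with \<open>p\<close>
  elements in the integers modulo \<open>p\<close>, expressed by integral lifts of the
  coefficients.\<close>

definition independent_mod :: "nat \<Rightarrow> 'k :: field_char_0 set \<Rightarrow> bool" where
  "independent_mod p S \<longleftrightarrow> finite S \<and> (\<forall>s\<in>S. algebraic_int s) \<and>
     (\<forall>c. algebraic_int ((\<Sum>s\<in>S. of_int (c s) * s) / of_nat p) \<longrightarrow> (\<forall>s\<in>S. int p dvd c s))"

text \<open>Infinite descent: in a rational relation with cleared denominators all coefficients are
  divisible by \<open>p\<close>, and division by \<open>p\<close> gives another relation. A nonzero
  integer is not divisible by every power of \<open>p\<close>.\<close>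

lemma independent_mod_imp_independent:
  assumes "independent_mod p S" "p > 1"
  shows "qvec.independent S"
proof
  assume "qvec.dependent S"
  have fin: "finite S" using assms(1) by (simp add: independent_mod_def)
  then obtain q v where q: "v \<in> S" "q v \<noteq> 0" "(\<Sum>s\<in>S. of_rat (q s) * s) = 0"
    using \<open>qvec.dependent S\<close> unfolding qvec.dependent_finite[OF fin] by blast
  obtain D where D: "D > 0" "\<forall>r\<in>q ` S. of_nat D * r \<in> \<int>" using common_denominator fin by blast
  then have "\<forall>s\<in>S. \<exists>c. of_nat D * q s = of_int c" by (auto elim: Ints_cases)
  then obtain c where c: "\<And>s. s \<in> S \<Longrightarrow> of_nat D * q s = of_int (c s)" by metis
  have "of_int (c s) * s = of_nat D * (of_rat (q s) * s)" if "s \<in> S" for s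
  proof -
    have "of_rat (of_nat D * q s) = (of_rat (of_int (c s)) :: 'a)" using c[OF that] by simp
    then show ?thesis by (simp add: of_rat_mult)
  qed
  then have "(\<Sum>s\<in>S. of_int (c s) * s) = of_nat D * (\<Sum>s\<in>S. of_rat (q s) * s)"
    unfolding sum_distrib_left by (rule sum.cong[OF refl])
  then have zero: "(\<Sum>s\<in>S. of_int (c s) * s) = 0" using q(3) by simp
  have "\<forall>s\<in>S. int p ^ k dvd c s" for k
  proof (induction k)
    case (Suc k)
    define c' where "c' s = c s div int p ^ k" for s
    have c': "c s = int p ^ k * c' s" if "s \<in> S" for s using Suc that by (simp add: c'_def)
    have "(\<Sum>s\<in>S. of_int (c s) * s) = of_nat (p ^ k) * (\<Sum>s\<in>S. of_int (c' s) * s)"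
      unfolding sum_distrib_left by (rule sum.cong) (simp_all add: c' mult.assoc)
    then have "(\<Sum>s\<in>S. of_int (c' s) * s) = 0" using zero assms(2) by simp
    then have "\<forall>s\<in>S. int p dvd c' s" using assms(1) unfolding independent_mod_def by simp
    then show ?case using c' by (simp add: mult.commute mult_dvd_mono)
  qed simp
  then have "int p ^ nat \<bar>c v\<bar> dvd c v" using q(1) by blast
  moreover have "of_nat D * q v \<noteq> 0" using D(1) q(2) by simp
  then have "c v \<noteq> 0" using c[OF q(1)] by auto
  ultimately have "int p ^ nat \<bar>c v\<bar> \<le> \<bar>c v\<bar>" 
    using dvd_imp_le_int[of "c v" "int p ^ nat \<bar>c v\<bar>"] by simp
  moreover have "nat \<bar>c v\<bar> < p ^ nat \<bar>c v\<bar>" using assms(2) by (intro power_gt_expt) simp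
  then have "\<bar>c v\<bar> < int p ^ nat \<bar>c v\<bar>" by (metis nat_less_iff abs_ge_zero of_nat_power)
  ultimately show False by simp
qed

text \<open>Sets independent modulo \<open>p\<close> are independent over the rationals, so their
  size is bounded. One of maximal size spans the integers modulo \<open>p\<close>, with finitely
  many coefficient vectors.\<close>

lemma finite_residues_prime:
  assumes k: "number_field TYPE('k :: field_char_0)" and p: "Factorial_Ring.prime (p :: nat)"
  shows "finite_residues TYPE('k) p"
proof -
  have p1: "p > 1" using p by (rule prime_gt_1_nat)
  obtain B0 :: "'k set" where B0: "finite B0" "qvec.span B0 = UNIV"
    using k by (auto simp: number_field_def)
  have bound: "card S \<le> card B0" if "independent_mod p S" for S :: "'k set"
    using qvec.independent_span_bound[OF B0(1) independent_mod_imp_independent[OF that p1]] B0(2) by simp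
  have "independent_mod p ({} :: 'k set)" by (simp add: independent_mod_def)
  moreover have "\<forall>S :: 'k set. independent_mod p S \<longrightarrow> card S < Suc (card B0)"
    using bound by (simp add: less_Suc_eq_le)
  ultimately obtain S :: "'k set" where S: "independent_mod p S"
      "\<And>S' :: 'k set. independent_mod p S' \<Longrightarrow> card S' \<le> card S"
    using ex_has_greatest_nat[of "independent_mod p" "{} :: 'k set" card "Suc (card B0)"] by auto
  have fin: "finite S" and S_int: "\<And>s. s \<in> S \<Longrightarrow> algebraic_int s"
    and S_ind: "\<And>c s. algebraic_int ((\<Sum>s\<in>S. of_int (c s) * s) / of_nat p) \<Longrightarrow> s \<in> S \<Longrightarrow> int p dvd c s"
    using S(1) unfolding independent_mod_def by blast+
  have rep: "\<exists>c. algebraic_int ((x - (\<Sum>s\<in>S. of_int (c s) * s)) / of_nat p)" if x: "algebraic_int x" for x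
  proof (cases "x \<in> S")
    case True
    have "(\<Sum>s\<in>S. of_int (if s = x then 1 else 0) * s) = (\<Sum>s\<in>S. if s = x then s else 0)"
      by (rule sum.cong) auto
    also have "\<dots> = x" using fin True by simp
    finally show ?thesis by (intro exI[of _ "\<lambda>s. if s = x then 1 else 0"]) simp
  next
    case False
    then have "\<not> independent_mod p (insert x S)" using S(2)[of "insert x S"] fin by auto
    then obtain c t where c: "algebraic_int ((\<Sum>s\<in>insert x S. of_int (c s) * s) / of_nat p)"
        "t \<in> insert x S" "\<not> int p dvd c t"
      unfolding independent_mod_def using fin S_int x by blast
    then have cx: "algebraic_int ((of_int (c x) * x + (\<Sum>s\<in>S. of_int (c s) * s)) / of_nat p)"
      using False fin by simp
    \<comment> \<open>Otherwise \<open>x\<close> drops out of the relation modulo \<open>p\<close>,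
      and independence of \<open>S\<close> makes every coefficient divisible by
      \<open>p\<close>.\<close>
    have ndvd: "\<not> int p dvd c x"
    proof
      assume "int p dvd c x"
      then obtain e where "c x = int p * e" by blast
      then have "(\<Sum>s\<in>S. of_int (c s) * s) / of_nat p
          = (of_int (c x) * x + (\<Sum>s\<in>S. of_int (c s) * s)) / of_nat p - of_int e * x"
        using p1 by (simp add: field_simps)
      also have "algebraic_int \<dots>" using cx x by blast
      finally have "int p dvd c s" if "s \<in> S" for s using S_ind that by blast
      then show False using c(2,3) \<open>int p dvd c x\<close> by blast
    qed
    have "Factorial_Ring.prime (int p)" using p by simp
    then have "gcd (c x) (int p) = 1"
      using prime_imp_coprime[OF _ ndvd] by (simp add: coprime_iff_gcd_eq_1 gcd.commute)
    \<comment> \<open>The multiplier \<open>e\<close> inverts \<open>c x\<close> modulo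
      \<open>p\<close>, which solves the relation for \<open>x\<close>.\<close>
    then obtain e f where ef: "e * c x + f * int p = 1" using bezout_int[of "c x" "int p"] by auto
    have "x = of_int (e * c x + f * int p) * x" by (simp add: ef)
    then have "x - (\<Sum>s\<in>S. of_int (- e * c s) * s)
      = of_int e * (of_int (c x) * x + (\<Sum>s\<in>S. of_int (c s) * s)) + of_nat p * (of_int f * x)"
      by (simp add: algebra_simps sum_distrib_left sum_negf)
    then have "(x - (\<Sum>s\<in>S. of_int (- e * c s) * s)) / of_nat p
      = of_int e * ((of_int (c x) * x + (\<Sum>s\<in>S. of_int (c s) * s)) / of_nat p) + of_int f * x"
      using p1 by (simp add: add_divide_distrib distrib_left)
    also have "algebraic_int \<dots>" using cx x by blast
    finally show ?thesis by (rule exI[of _ "\<lambda>s. - e * c s"])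
  qed
  let ?R = "(\<lambda>c. \<Sum>s\<in>S. of_int (c s) * s) ` (S \<rightarrow>\<^sub>E {0..<int p})"
  have "\<exists>r\<in>?R. algebraic_int ((x - r) / of_nat p)" if x: "algebraic_int x" for x
  proof -
    obtain c where c: "algebraic_int ((x - (\<Sum>s\<in>S. of_int (c s) * s)) / of_nat p)"
      using rep[OF x] by blast
    define r where "r = (\<Sum>s\<in>S. of_int (restrict (\<lambda>s. c s mod int p) S s) * s)"
    have "of_int (c s) * s = of_int (restrict (\<lambda>s. c s mod int p) S s) * s + of_nat p * (of_int (c s div int p) * s)"
      if "s \<in> S" for s
    proof -
      have "of_int (c s) = (of_int (c s mod int p + int p * (c s div int p)) :: 'k)" by simp
      then show ?thesis using that by (simp only: restrict_apply if_True of_int_add of_int_mult of_int_of_nat_eq distrib_right mult.assoc)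
    qed
    then have "(\<Sum>s\<in>S. of_int (c s) * s) = r + of_nat p * (\<Sum>s\<in>S. of_int (c s div int p) * s)"
      unfolding r_def sum_distrib_left sum.distrib[symmetric] by (rule sum.cong[OF refl])
    then have "(x - r) / of_nat p = (x - (\<Sum>s\<in>S. of_int (c s) * s)) / of_nat p + (\<Sum>s\<in>S. of_int (c s div int p) * s)"
      using p1 by (simp add: field_simps)
    also have "algebraic_int \<dots>"
      using c S_int by (intro algebraic_int_add algebraic_int_sum algebraic_int_times) auto
    finally have "algebraic_int ((x - r) / of_nat p)" .
    moreover have "r \<in> ?R" unfolding r_def using p1 by (intro imageI) auto
    ultimately show ?thesis by blast
  qed
  moreover have "finite ?R" by (intro finite_imageI finite_PiE fin) simp
  moreover have "\<forall>r\<in>?R. algebraic_int r" using S_int by auto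
  ultimately show ?thesis unfolding finite_residues_def by (intro exI[of _ ?R] conjI allI impI)
qed

lemma number_field_finite_residues:
  assumes k: "number_field TYPE('k :: field_char_0)" and "N > 0"
  shows "finite_residues TYPE('k) N"
  using assms(2)
proof (induction N rule: less_induct)
  case (less N)
  show ?case
  proof (cases "N = 1")
    case True
    have "\<exists>r\<in>{0 :: 'k}. algebraic_int ((x - r) / of_nat N)" if "algebraic_int x" for x
      using that True by simp
    then show ?thesis unfolding finite_residues_def by (intro exI[of _ "{0}"]) auto
  next
    case False
    then obtain p where p: "Factorial_Ring.prime p" "p dvd N" using prime_factor_nat by blast
    then obtain M where M: "N = p * M" by blast
    have "p > 1" using p(1) by (rule prime_gt_1_nat)
    then have "finite_residues TYPE('k) M" using less M by (intro less.IH) auto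
    then show ?thesis unfolding M using \<open>p > 1\<close> less.prems M
      by (intro finite_residues_mult finite_residues_prime[OF k p(1)]) auto
  qed
qed

section \<open>Finite extensions and a universal binary form\<close>

interpretation acmod: ring_scalars "to_ac :: 'k :: field \<Rightarrow> 'k alg_closure"
  by standard simp_all

lemma algebraic_power_relation:
  fixes y :: "'k :: field alg_closure"
  shows "\<exists>n c. n > 0 \<and> y ^ n = (\<Sum>i<n. to_ac (c i) * y ^ i)"
proof -
  obtain p :: "'k poly" where p: "p \<noteq> 0" "poly (map_poly to_ac p) y = 0"
    using alg_closure_algebraic by blast
  define q where "q = smult (inverse (lead_coeff p)) p"
  define P where "P = map_poly to_ac q"
  have "lead_coeff p \<noteq> 0" using p(1) by simp
  then have lead: "lead_coeff P = 1"
    by (simp add: P_def q_def degree_map_poly coeff_map_poly)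
  have "P = smult (to_ac (inverse (lead_coeff p))) (map_poly to_ac p)"
    unfolding P_def q_def by (intro poly_eqI) (simp add: coeff_map_poly)
  then have root: "poly P y = 0" using p(2) by simp
  have "- Polynomial.coeff P i = to_ac (- Polynomial.coeff q i)" for i
    by (simp add: P_def coeff_map_poly)
  then have "y ^ Polynomial.degree P = (\<Sum>i<Polynomial.degree P. to_ac (- Polynomial.coeff q i) * y ^ i)"
    using monic_root_power[OF lead root] by (simp only:)
  then show ?thesis using monic_root_degree_pos[OF lead root] by (intro exI conjI)
qed

lemma alg_closure_stable_module:
  fixes E :: "'k :: field alg_closure set"
  assumes "finite E"
  shows "\<exists>S. finite S \<and> 1 \<in> S \<and> (\<forall>x\<in>E. \<forall>s\<in>S. x * s \<in> acmod.span S)"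
  using assms
proof (induction rule: finite_induct)
  case empty
  then show ?case by (intro exI[of _ "{1}"]) auto
next
  case (insert y E)
  then obtain S where S: "finite S" "1 \<in> S" "\<And>x s. x \<in> E \<Longrightarrow> s \<in> S \<Longrightarrow> x * s \<in> acmod.span S"
    by blast
  obtain n c where n: "n > 0" "y ^ n = (\<Sum>i<n. to_ac (c i) * y ^ i)"
    using algebraic_power_relation by blast
  have coeff: "to_ac (c i) * s \<in> acmod.span S" if "s \<in> S" for i s
    using that by (intro acmod.span_scale acmod.span_base)
  show ?case by (rule acmod.stable_module_adjoin[OF S n coeff])
qed

text \<open>Factors of the nonzero \<open>x\<close> are cancelled from an annihilating polynomial
  until its constant term \<open>a\<close> is nonzero; then \<open>x\<close> divides
  \<open>a\<close> by a polynomial in \<open>x\<close>.\<close>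

lemma alg_closure_inverse_polynomial:
  fixes x :: "'k :: field alg_closure"
  assumes "x \<noteq> 0"
  shows "\<exists>q. inverse x = poly (map_poly to_ac q) x"
proof -
  have "\<exists>a q. a \<noteq> 0 \<and> to_ac a + x * poly (map_poly to_ac q) x = 0"
    if "p \<noteq> 0" "poly (map_poly to_ac p) x = 0" for p :: "'k poly"
    using that
  proof (induction p)
    case (pCons a p)
    show ?case
    proof (cases "a = 0")
      case True
      then have "p \<noteq> 0" "poly (map_poly to_ac p) x = 0"
        using pCons.prems assms by (auto simp: map_poly_pCons)
      then show ?thesis by (rule pCons.IH)
    next
      case False
      then show ?thesis using pCons.prems by (intro exI[of _ a] exI[of _ p]) (simp add: map_poly_pCons)
    qed
  qed simp
  then obtain a q where a: "a \<noteq> 0" "to_ac a + x * poly (map_poly to_ac q) x = 0"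
    using alg_closure_algebraic[of x] by metis
  let ?q = "smult (- inverse a) q"
  have "map_poly to_ac ?q = smult (to_ac (- inverse a)) (map_poly to_ac q)"
    by (intro poly_eqI) (simp add: coeff_map_poly)
  then have "x * poly (map_poly to_ac ?q) x = - inverse (to_ac a) * (x * poly (map_poly to_ac q) x)"
    by simp
  also have "x * poly (map_poly to_ac q) x = - to_ac a" using a(2) by (simp add: eq_neg_iff_add_eq_0 add.commute)
  finally have "x * poly (map_poly to_ac ?q) x = 1" using a(1) by simp
  then show ?thesis by (intro exI[of _ ?q]) (rule inverse_unique)
qed

section \<open>Subfields in terms of the type class operations\<close>

lemma type_algebra_simps:
  fixes x y :: "'a :: Fields.field"
  shows "carrier ring_of_type_algebra = (UNIV :: 'a set)" "\<one>\<^bsub>ring_of_type_algebra\<^esub> = (1 :: 'a)"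
    "\<zero>\<^bsub>ring_of_type_algebra\<^esub> = (0 :: 'a)" "x \<otimes>\<^bsub>ring_of_type_algebra\<^esub> y = x * y"
    "x \<oplus>\<^bsub>ring_of_type_algebra\<^esub> y = x + y" "\<ominus>\<^bsub>ring_of_type_algebra\<^esub> x = - x"
    "x \<noteq> 0 \<Longrightarrow> inv\<^bsub>ring_of_type_algebra\<^esub> x = inverse x"
proof -
  interpret R: Ring.field "ring_of_type_algebra :: 'a ring" by (rule field_from_type_algebra)
  show simps: "carrier ring_of_type_algebra = (UNIV :: 'a set)" "\<one>\<^bsub>ring_of_type_algebra\<^esub> = (1 :: 'a)"
    "\<zero>\<^bsub>ring_of_type_algebra\<^esub> = (0 :: 'a)" "x \<otimes>\<^bsub>ring_of_type_algebra\<^esub> y = x * y"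
    "x \<oplus>\<^bsub>ring_of_type_algebra\<^esub> y = x + y" for x y :: 'a
    by (simp_all add: ring_of_type_algebra_def)
  show "\<ominus>\<^bsub>ring_of_type_algebra\<^esub> x = - x"
    by (rule R.minus_equality) (simp_all add: simps)
  show "inv\<^bsub>ring_of_type_algebra\<^esub> x = inverse x" if "x \<noteq> 0"
    by (rule R.comm_inv_char) (simp_all add: simps that)
qed

lemma subfield_type_algebraI:
  fixes K :: "'a :: Fields.field set"
  assumes "1 \<in> K" "\<And>x. x \<in> K \<Longrightarrow> - x \<in> K" "\<And>x y. x \<in> K \<Longrightarrow> y \<in> K \<Longrightarrow> x * y \<in> K"
    "\<And>x y. x \<in> K \<Longrightarrow> y \<in> K \<Longrightarrow> x + y \<in> K" "\<And>x. x \<in> K \<Longrightarrow> x \<noteq> 0 \<Longrightarrow> inverse x \<in> K"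
  shows "subfield K ring_of_type_algebra"
proof -
  interpret R: Ring.field "ring_of_type_algebra :: 'a ring" by (rule field_from_type_algebra)
  show ?thesis
  proof (rule R.subfieldI')
    show "subring K ring_of_type_algebra"
      by (rule R.subringI) (use assms in \<open>auto simp: type_algebra_simps\<close>)
    show "inv\<^bsub>ring_of_type_algebra\<^esub> x \<in> K" if "x \<in> K - {\<zero>\<^bsub>ring_of_type_algebra\<^esub>}" for x
      using that assms(5) by (simp add: type_algebra_simps)
  qed
qed

lemma subfield_type_algebra_closed:
  fixes K :: "'a :: Fields.field set"
  assumes "subfield K ring_of_type_algebra"
  shows "x \<in> K \<Longrightarrow> y \<in> K \<Longrightarrow> x * y \<in> K" "x \<in> K \<Longrightarrow> y \<in> K \<Longrightarrow> x + y \<in> K"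
    "x \<in> K \<Longrightarrow> - x \<in> K" "x \<in> K \<Longrightarrow> y \<in> K \<Longrightarrow> x - y \<in> K"
    "x \<in> K \<Longrightarrow> y \<in> K \<Longrightarrow> y \<noteq> 0 \<Longrightarrow> x / y \<in> K"
proof -
  interpret R: Ring.field "ring_of_type_algebra :: 'a ring" by (rule field_from_type_algebra)
  note E = subringE[OF subfieldE(1)[OF assms], unfolded type_algebra_simps]
  show mult: "x * y \<in> K" if "x \<in> K" "y \<in> K" for x y using E(6) that .
  show add: "x + y \<in> K" if "x \<in> K" "y \<in> K" for x y using E(7) that .
  show neg: "- x \<in> K" if "x \<in> K" for x using E(5)[OF that] by simp
  show "x - y \<in> K" if "x \<in> K" "y \<in> K" using add[OF that(1) neg[OF that(2)]] by simp
  show "x / y \<in> K" if "x \<in> K" "y \<in> K" "y \<noteq> 0"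
  proof -
    have "inverse y \<in> K" using R.subfield_m_inv(1)[OF assms, of y] that by (simp add: type_algebra_simps)
    then show ?thesis using mult[OF that(1)] by (simp add: divide_inverse)
  qed
qed

text \<open>The field is the multiplier ring of a finite-dimensional space that is stable under the
  given elements.\<close>

lemma finite_extension_exists:
  fixes E :: "'k :: field_char_0 alg_closure set"
  assumes "finite E"
  shows "\<exists>K. finite_extension K \<and> E \<subseteq> K"
proof -
  obtain S where S: "finite S" "1 \<in> S" "\<forall>x\<in>E. \<forall>s\<in>S. x * s \<in> acmod.span S"
    using alg_closure_stable_module[OF assms] by blast
  define K where "K = {x. \<forall>s\<in>S. x * s \<in> acmod.span S}"
  have E: "E \<subseteq> K" using S(3) by (auto simp: K_def)
  have K_ac: "to_ac c \<in> K" for c unfolding K_def by (auto intro: acmod.span_scale acmod.span_base)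
  have K_add: "x + y \<in> K" if "x \<in> K" "y \<in> K" for x y
    using that by (auto simp: K_def distrib_right intro: acmod.span_add)
  have K_mult: "x * y \<in> K" if "x \<in> K" "y \<in> K" for x y
    using that acmod.span_mult_closed[of S x S] by (auto simp: K_def mult.assoc)
  have K_pow: "x ^ n \<in> K" if "x \<in> K" for x n
    by (induction n) (use K_ac[of 1] K_mult that in auto)
  have K_sum: "(\<Sum>i\<in>J. f i) \<in> K" if "\<And>i. i \<in> J \<Longrightarrow> f i \<in> K" for J :: "nat set" and f
    using that K_ac[of 0] by (induction J rule: infinite_finite_induct) (auto intro: K_add)
  have sub: "subfield K ring_of_type_algebra"
  proof (rule subfield_type_algebraI)
    show "1 \<in> K" using K_ac[of 1] by simp
    show "- x \<in> K" if "x \<in> K" for x using K_mult[OF K_ac[of "- 1"] that] by simp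
    show "inverse x \<in> K" if x: "x \<in> K" "x \<noteq> 0" for x
    proof -
      obtain q where q: "inverse x = poly (map_poly to_ac q) x"
        using alg_closure_inverse_polynomial[OF x(2)] by blast
      show ?thesis unfolding q poly_altdef
        by (intro K_sum K_mult K_pow x(1)) (simp add: coeff_map_poly K_ac)
    qed
  qed (use K_mult K_add in auto)
  interpret V: Vector_Spaces.vector_space "\<lambda>(c :: 'k) x. to_ac c * x"
    by standard (simp_all add: algebra_simps)
  \<comment> \<open>A multiplier \<open>x\<close> equals \<open>x * 1\<close> with 1 in
    \<open>S\<close>, so the dimension of \<open>K\<close> is bounded by the size of
    \<open>S\<close>.\<close>
  have K_span: "K \<subseteq> acmod.span S" using S(2) by (force simp: K_def)
  have "acmod.subspace K"
    using K_ac[of 0] K_add K_mult[OF K_ac] by (intro acmod.subspaceI) auto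
  obtain B where B: "B \<subseteq> K" "acmod.independent B" "K \<subseteq> acmod.span B"
    using V.maximal_independent_subset[of K] by blast
  have "finite B"
    using V.independent_span_bound[OF S(1) B(2)] B(1) K_span by blast
  moreover have "acmod.span B = K"
    using B(3) acmod.span_minimal[OF B(1) \<open>acmod.subspace K\<close>] by blast
  ultimately have "finite_extension K"
    unfolding finite_extension_def using sub K_ac by blast
  then show ?thesis using E by blast
qed

section \<open>Denominators, and integral values of a split binary form\<close>

lemma number_field_denominator:
  assumes "number_field TYPE('k :: field_char_0)"
  shows "\<exists>D > 0. algebraic_int (of_nat D * (x :: 'k))"
proof -
  obtain I :: "'k set" and w :: "'k \<Rightarrow> 'k" and co where co: "integral_coordinates I w co"
    using number_field_coordinates[OF assms] by blast
  interpret integral_coordinates I w co by (rule co)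
  obtain D where D: "D > 0" "of_nat D * x \<in> lat" using exists_denominator by blast
  obtain l where l: "l \<in> I" using basis_nonempty by blast
  have "algebraic_int (of_nat D * x)"
  proof (rule algebraic_intI_stable)
    show "finite (w ` I)" "w l \<in> w ` I" "w l \<noteq> 0" using finite_I l basis_nonzero by auto
    show "of_nat D * x * s \<in> zspan (w ` I)" if "s \<in> w ` I" for s
      using that D(2) by (auto intro!: lat_in_zspan lat_mult_closed lat_closed)
  qed
  then show ?thesis using D(1) by blast
qed

lemma alg_closure_denominator:
  fixes z :: "'k :: field_char_0 alg_closure"
  assumes "number_field TYPE('k)"
  shows "\<exists>D > 0. algebraic_int (of_nat D * z)"
proof -
  obtain n and c :: "nat \<Rightarrow> 'k" where n: "n > 0" "z ^ n = (\<Sum>i<n. to_ac (c i) * z ^ i)"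
    using algebraic_power_relation by blast
  have "\<forall>i. \<exists>D > 0. algebraic_int (of_nat D * c i)"
    using number_field_denominator[OF assms] by blast
  then obtain d where d: "\<And>i. d i > (0 :: nat)" "\<And>i. algebraic_int (of_nat (d i) * c i)" by metis
  define D where "D = (\<Prod>i<n. d i)"
  have D0: "D > 0" unfolding D_def using d(1) by (simp add: prod_pos)
  have D: "algebraic_int (of_nat D * to_ac (c i))" if "i < n" for i
  proof -
    have "d i dvd D" unfolding D_def using that by (intro dvd_prodI) auto
    then obtain k where "D = d i * k" by blast
    then have "of_nat D * to_ac (c i) = of_nat k * to_ac (of_nat (d i) * c i)" by simp
    also have "algebraic_int \<dots>"
      by (intro algebraic_int_times algebraic_int_of_nat algebraic_int_to_ac d(2))
    finally show ?thesis .
  qed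
  have "algebraic_int (of_nat D * z)"
  proof (rule algebraic_int_integrally_closed[OF n(1)])
    \<comment> \<open>The relation for \<open>z\<close> is multiplied by \<open>D ^ n\<close>:
      \<open>i\<close> factors go to \<open>z ^ i\<close>, one clears the denominator of
      \<open>c i\<close>, and \<open>n - 1 - i\<close> are left over.\<close>
    show "(of_nat D * z) ^ n = (\<Sum>i<n. (of_nat D ^ (n - 1 - i) * (of_nat D * to_ac (c i))) * (of_nat D * z) ^ i)"
      unfolding power_mult_distrib n(2) sum_distrib_left
    proof (rule sum.cong[OF refl])
      fix i assume "i \<in> {..<n}"
      then have "n = (n - 1 - i) + 1 + i" by simp
      then have "(of_nat D :: 'k alg_closure) ^ n = of_nat D ^ (n - 1 - i) * of_nat D * of_nat D ^ i"
        by (metis power_add power_one_right)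
      then show "of_nat D ^ n * (to_ac (c i) * z ^ i)
        = of_nat D ^ (n - 1 - i) * (of_nat D * to_ac (c i)) * (of_nat D ^ i * z ^ i)"
        by (simp add: mult_ac)
    qed
    show "algebraic_int (of_nat D ^ (n - 1 - i) * (of_nat D * to_ac (c i)))" if "i < n" for i
      by (intro algebraic_int_times algebraic_int_pow algebraic_int_of_nat D that)
  qed
  then show ?thesis using D0 by blast
qed

lemma binary_form_universal:
  fixes c :: "'k :: field_char_0 alg_closure"
  assumes k: "number_field TYPE('k)" and c: "algebraic_int c" "c \<noteq> 0"
  shows "\<exists>E. finite E \<and> (\<forall>K. finite_extension K \<longrightarrow> E \<subseteq> K \<longrightarrow>
    (\<forall>a. algebraic_int a \<longrightarrow> (\<exists>x\<in>ring_of_integers K. \<exists>y\<in>ring_of_integers K.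
      x\<^sup>2 - c\<^sup>2 * y\<^sup>2 = to_ac a)))"
proof -
  \<comment> \<open>The factor 4 makes \<open>N\<close> divisible by the square of
    \<open>2 * c\<close>, the modulus for which the two linear factors have to agree.\<close>
  obtain N where N: "N > 0" "algebraic_int (of_nat N * inverse (4 * c\<^sup>2))"
    using alg_closure_denominator[OF k] by blast
  have N0: "of_nat N \<noteq> (0 :: 'k alg_closure)" using N(1) by simp
  obtain R :: "'k set" where R: "finite R" "\<And>r. r \<in> R \<Longrightarrow> algebraic_int r"
    "\<And>x. algebraic_int x \<Longrightarrow> \<exists>r\<in>R. algebraic_int ((x - r) / of_nat N)"
    using number_field_finite_residues[OF k N(1)] unfolding finite_residues_def by blast
  have "\<forall>r\<in>R. \<exists>e. e \<noteq> 0 \<and> algebraic_int e \<and> algebraic_int (of_nat N / e) \<and> algebraic_int ((e - to_ac r) / of_nat N)"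
    using divisor_in_residue_class[OF k R(2) N(1)] by blast
  then obtain e where e: "\<And>r. r \<in> R \<Longrightarrow> e r \<noteq> 0" "\<And>r. r \<in> R \<Longrightarrow> algebraic_int (e r)"
    "\<And>r. r \<in> R \<Longrightarrow> algebraic_int (of_nat N / e r)" "\<And>r. r \<in> R \<Longrightarrow> algebraic_int ((e r - to_ac r) / of_nat N)"
    by metis
  \<comment> \<open>One square root for each of the finitely many residues; only these and
    \<open>c\<close> have to be adjoined, independently of \<open>a\<close>.\<close>
  have "\<forall>r. \<exists>f. f ^ 2 = e r" using nth_root_exists[of 2] by auto
  then obtain f where f: "\<And>r. f r ^ 2 = e r" by metis
  have "\<exists>x\<in>ring_of_integers K. \<exists>y\<in>ring_of_integers K. x\<^sup>2 - c\<^sup>2 * y\<^sup>2 = to_ac a"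
    if K: "finite_extension K" "insert c (f ` R) \<subseteq> K" and a: "algebraic_int a" for K a
  proof -
    obtain r where r: "r \<in> R" "algebraic_int ((a - r) / of_nat N)" using R(3)[OF a] by blast
    have sub: "subfield K ring_of_type_algebra" and ac: "\<And>b. to_ac b \<in> K"
      using K(1) by (auto simp: finite_extension_def)
    note closed = subfield_type_algebra_closed[OF sub]
    have f0: "f r \<noteq> 0" using e(1)[OF r(1)] f[of r] by auto
    have f_int: "algebraic_int (f r)" using algebraic_int_root_power[of 2 "f r"] e(2)[OF r(1)] f by simp
    define q where "q = of_nat N / (2 * c * f r)"
    define z where "z = (to_ac a - e r) / of_nat N"
    have nat: "of_nat m \<in> K" for m using ac[of "of_nat m"] by simp
    have inK: "c \<in> K" "f r \<in> K" using K(2) r(1) by auto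
    have "2 \<in> K" using nat[of 2] by simp
    then have q_K: "q \<in> K" unfolding q_def using c(2) f0 inK nat by (intro closed) auto
    have z_K: "z \<in> K" unfolding z_def f[symmetric] power2_eq_square
      using inK nat ac N0 by (intro closed) auto
    \<comment> \<open>The square is a product of two integral quotients, one from \<open>e r\<close>
      dividing \<open>N\<close> and one from the choice of \<open>N\<close>; hence \<open>q\<close>
      itself is integral.\<close>
    have "q\<^sup>2 = (of_nat N * of_nat N) / (4 * c\<^sup>2 * e r)"
      unfolding q_def power_divide power_mult_distrib f by (simp add: power2_eq_square)
    also have "\<dots> = (of_nat N / e r) * (of_nat N * inverse (4 * c\<^sup>2))"
      using e(1)[OF r(1)] c(2) by (simp add: field_simps)
    also have "algebraic_int \<dots>" using e(3)[OF r(1)] N(2) by (rule algebraic_int_times)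
    finally have q_int: "algebraic_int q" by (rule algebraic_int_root_power[rotated]) simp
    have "z = to_ac ((a - r) / of_nat N) - (e r - to_ac r) / of_nat N"
      unfolding z_def by (simp add: diff_divide_distrib)
    also have "algebraic_int \<dots>"
      by (intro algebraic_int_diff algebraic_int_to_ac r(2) e(4)[OF r(1)])
    finally have z_int: "algebraic_int z" .
    \<comment> \<open>These are the solutions of \<open>x + c * y = f r\<close> and
      \<open>x - c * y = f r + (N / f r) * z\<close>.\<close>
    have "f r + c * q * z \<in> ring_of_integers K" "- (q * z) \<in> ring_of_integers K"
      unfolding ring_of_integers_def using f_int c(1) q_int z_int inK q_K z_K
      by (auto intro!: closed)
    moreover have "(f r + c * q * z)\<^sup>2 - c\<^sup>2 * (- (q * z))\<^sup>2 = to_ac a"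
    proof -
      have "(f r + c * q * z)\<^sup>2 - c\<^sup>2 * (- (q * z))\<^sup>2 = (f r)\<^sup>2 + (2 * c * f r * q) * z"
        by (simp add: power2_eq_square algebra_simps)
      also have "2 * c * f r * q = of_nat N" unfolding q_def using c(2) f0 by simp
      also have "(f r)\<^sup>2 + of_nat N * z = to_ac a" unfolding z_def f using N0 by simp
      finally show ?thesis .
    qed
    ultimately show ?thesis by blast
  qed
  then show ?thesis using R(1) by (intro exI[of _ "insert c (f ` R)"]) auto
qed

section \<open>Lattices\<close>

text \<open>Multiplication of a tensor by a scalar, acting on the second factor of each pure tensor.
  It is defined on formal combinations, where the scalars may be any elements of the
  closure.\<close>

definition frag_scale :: "'a :: field_char_0 alg_closure \<Rightarrow> ('v \<times> 'a alg_closure \<Rightarrow>\<^sub>0 int) \<Rightarrow> ('v \<times> 'a alg_closure \<Rightarrow>\<^sub>0 int)" where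
  "frag_scale x = frag_extend (\<lambda>p. frag_of (fst p, x * snd p))"

lemma keys_frag_scale: "Poly_Mapping.keys (frag_scale x f) \<subseteq> (\<lambda>p. (fst p, x * snd p)) ` Poly_Mapping.keys f"
  unfolding frag_scale_def by (rule order.trans[OF keys_frag_extend]) auto

lemma formal_bilinear_0_left: "formal_bilinear Q 0 g = 0"
  by (simp add: formal_bilinear_def)

lemma formal_bilinear_scale_left: "formal_bilinear Q (frag_scale x f) g = x * formal_bilinear Q f g"
proof -
  have "Poly_Mapping.keys f \<subseteq> UNIV" by simp
  then show ?thesis
  proof (induction f rule: frag_induction)
    case zero
    then show ?case by (simp add: frag_scale_def formal_bilinear_0_left)
  next
    case (one p)
    obtain v b where "p = (v, b)" by (cases p)
    then show ?case
      by (simp add: frag_scale_def formal_bilinear_frag_of_left sum_distrib_left mult_ac)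
  next
    case (diff f g)
    then show ?case
      by (simp add: frag_scale_def frag_extend_diff formal_bilinear_diff_left right_diff_distrib)
  qed
qed

lemma formal_bilinear_scale_right: "formal_bilinear Q g (frag_scale x f) = x * formal_bilinear Q g f"
  by (metis formal_bilinear_commute formal_bilinear_scale_left)

lemma quadratic_space_polar:
  assumes "quadratic_space scale Q"
  shows "polar_form Q (x + y) z = polar_form Q x z + polar_form Q y z"
    "polar_form Q (scale c x) z = c * polar_form Q x z"
    "polar_form Q (x - y) z = polar_form Q x z - polar_form Q y z"
proof -
  have "Vector_Spaces.linear scale (*) (\<lambda>x. polar_form Q x z)"
    using assms by (simp add: quadratic_space_def)
  then have hom: "module_hom scale (*) (\<lambda>x. polar_form Q x z)"
    by (rule Vector_Spaces.linear.axioms(3))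
  show "polar_form Q (x + y) z = polar_form Q x z + polar_form Q y z"
    "polar_form Q (scale c x) z = c * polar_form Q x z"
    "polar_form Q (x - y) z = polar_form Q x z - polar_form Q y z"
    using module_hom.add[OF hom] module_hom.scale[OF hom] module_hom.diff[OF hom] by simp_all
qed

lemma quadratic_lattice_closed:
  assumes Q: "quadratic_space scale Q" and L: "quadratic_lattice scale Q L"
  shows "x \<in> L \<Longrightarrow> y \<in> L \<Longrightarrow> x + y \<in> L" "x \<in> L \<Longrightarrow> algebraic_int c \<Longrightarrow> scale c x \<in> L"
proof -
  interpret V: Vector_Spaces.vector_space scale using Q by (simp add: quadratic_space_def)
  obtain F where F: "finite F" "L = {\<Sum>x\<in>F. scale (c x) x | c. \<forall>x\<in>F. algebraic_int (c x)}"
    using L unfolding quadratic_lattice_def ring_of_integers_def by auto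
  show "x + y \<in> L" if xy: "x \<in> L" "y \<in> L" for x y
  proof -
    obtain a b where "x = (\<Sum>v\<in>F. scale (a v) v)" "y = (\<Sum>v\<in>F. scale (b v) v)"
      and int: "\<forall>v\<in>F. algebraic_int (a v)" "\<forall>v\<in>F. algebraic_int (b v)"
      using xy unfolding F(2) by blast
    then have "x + y = (\<Sum>v\<in>F. scale (a v + b v) v)"
      by (simp add: V.scale_left_distrib sum.distrib)
    moreover have "\<forall>v\<in>F. algebraic_int (a v + b v)" using int by blast
    ultimately show ?thesis unfolding F(2) by (intro CollectI exI conjI)
  qed
  show "scale c x \<in> L" if x: "x \<in> L" and c: "algebraic_int c" for x c
  proof -
    obtain a where "x = (\<Sum>v\<in>F. scale (a v) v)" and int: "\<forall>v\<in>F. algebraic_int (a v)"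
      using x unfolding F(2) by blast
    then have "scale c x = (\<Sum>v\<in>F. scale (c * a v) v)"
      by (simp add: V.scale_sum_right)
    moreover have "\<forall>v\<in>F. algebraic_int (c * a v)" using int c by blast
    ultimately show ?thesis unfolding F(2) by (intro CollectI exI conjI)
  qed
qed

lemma keys_diff_subset:
  "Poly_Mapping.keys f \<subseteq> A \<Longrightarrow> Poly_Mapping.keys g \<subseteq> A \<Longrightarrow> Poly_Mapping.keys (f - g) \<subseteq> A"
  for f g :: "'a \<Rightarrow>\<^sub>0 int"
  using keys_diff[of f g] by blast

text \<open>All later computations take place with formal combinations instead of cosets. The
  closure properties of \<open>L\<close> and of the integers of \<open>K\<close> put the relations
  into the free group, so that \<open>extended_form_coset\<close> applies.\<close>

lemma extended_values_iff:
  assumes Q: "quadratic_space scale Q" and L: "quadratic_lattice scale Q L" and K: "finite_extension K"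
  shows "v \<in> extended_values scale Q L K \<longleftrightarrow>
    (\<exists>f. Poly_Mapping.keys f \<subseteq> L \<times> ring_of_integers K \<and> v = formal_bilinear Q f f)"
proof -
  have sub: "subfield K ring_of_type_algebra" and ac: "\<And>b. to_ac b \<in> K"
    using K by (auto simp: finite_extension_def)
  note closed = subfield_type_algebra_closed[OF sub]
  let ?F = "free_Abelian_group (L \<times> ring_of_integers K)"
  have rel: "tensor_relations scale L K \<subseteq> carrier ?F"
  proof
    fix r assume "r \<in> tensor_relations scale L K"
    then show "r \<in> carrier ?F"
    proof cases
      case (add_left x y a)
      have "x + y \<in> L" using add_left quadratic_lattice_closed(1)[OF Q L] by blast
      then show ?thesis unfolding carrier_free_Abelian_group_iff add_left(1)
        using add_left(2-) by (intro keys_diff_subset) simp_all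
    next
      case (add_right x a b)
      have "a + b \<in> ring_of_integers K" using add_right closed(2) by (auto simp: ring_of_integers_def)
      then show ?thesis unfolding carrier_free_Abelian_group_iff add_right(1)
        using add_right(2-) by (intro keys_diff_subset) simp_all
    next
      case (balanced x a c)
      have "to_ac c * a \<in> ring_of_integers K" using balanced closed(1) ac
        by (auto simp: ring_of_integers_def intro!: algebraic_int_times algebraic_int_to_ac)
      moreover have "scale c x \<in> L" using balanced quadratic_lattice_closed(2)[OF Q L]
        by (auto simp: ring_of_integers_def)
      ultimately show ?thesis unfolding carrier_free_Abelian_group_iff balanced(1)
        using balanced(2-) by (intro keys_diff_subset) simp_all
    qed
  qed
  have "carrier (base_change scale L K) = (\<lambda>f. generate ?F (tensor_relations scale L K) #>\<^bsub>?F\<^esub> f) ` carrier ?F"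
    by (auto simp: base_change_def Let_def FactGroup_def RCOSETS_def)
  then have "extended_values scale Q L K = (\<lambda>f. formal_bilinear Q f f) ` carrier ?F"
    unfolding extended_values_def by (simp add: image_image extended_form_coset[OF Q rel])
  then show ?thesis by (simp add: image_iff Bex_def)
qed

text \<open>Otherwise the form would be the square of a linear form, hence degenerate in rank 2.\<close>

lemma anisotropic_projection:
  fixes scale :: "'k :: field_char_0 \<Rightarrow> 'v :: ab_group_add \<Rightarrow> 'v"
  assumes Q: "quadratic_space scale Q" and L: "quadratic_lattice scale Q L"
    and rank: "lattice_rank scale L \<ge> 2"
  shows "\<exists>l\<in>L. to_ac (polar_form Q l l) \<noteq> (formal_bilinear Q (frag_of (l, 1)) f)\<^sup>2"
proof (rule ccontr)
  interpret V: Vector_Spaces.vector_space scale using Q by (simp add: quadratic_space_def)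
  note polar = quadratic_space_polar[OF Q]
  \<comment> \<open>If \<open>f\<close> has norm 1, the component of \<open>l\<close> orthogonal to
    \<open>f\<close> has norm \<open>Q l\<close> minus the square of \<open>h l\<close>; it is this
    norm that must not vanish throughout \<open>L\<close>.\<close>
  define h where "h l = formal_bilinear Q (frag_of (l, 1)) f" for l
  have h_add: "h (x + y) = h x + h y" for x y
    by (simp add: h_def formal_bilinear_frag_of_left polar(1) distrib_left sum.distrib)
  assume "\<not> (\<exists>l\<in>L. to_ac (polar_form Q l l) \<noteq> (formal_bilinear Q (frag_of (l, 1)) f)\<^sup>2)"
  then have sq: "to_ac (polar_form Q l l) = (h l)\<^sup>2" if "l \<in> L" for l using that by (simp add: h_def)
  \<comment> \<open>Polarisation of the equality of the form with the square of the additive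
    function \<open>h\<close>.\<close>
  have rank_one: "to_ac (polar_form Q x y) = h x * h y" if "x \<in> L" "y \<in> L" for x y
  proof -
    have "polar_form Q (x + y) (x + y) = polar_form Q x x + 2 * polar_form Q x y + polar_form Q y y"
      using polar(1) polar_form_commute by (metis (no_types, opaque_lifting) add.assoc mult_2)
    then have "to_ac (polar_form Q (x + y) (x + y)) = (h x)\<^sup>2 + 2 * to_ac (polar_form Q x y) + (h y)\<^sup>2"
      using sq that by simp
    moreover have "to_ac (polar_form Q (x + y) (x + y)) = (h x + h y)\<^sup>2"
      using sq[OF quadratic_lattice_closed(1)[OF Q L that]] by (simp add: h_add)
    ultimately show ?thesis by (simp add: power2_sum)
  qed
  have nondeg: "u = 0" if u: "u \<in> V.span L" "\<And>m. m \<in> L \<Longrightarrow> polar_form Q u m = 0" for u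
  proof -
    have "polar_form Q u y = 0" if "y \<in> V.span L" for y
      using that
    proof (induction rule: V.span_induct_alt)
      case base
      show ?case using polar(3)[of u u 0] polar_form_commute[of Q 0 u] polar(3)[of 0 0 u] by simp
    next
      case (step c x y)
      have "polar_form Q (scale c x + y) u = 0"
        using step u(2)[of x] polar_form_commute[of Q u x] polar_form_commute[of Q u y]
        by (simp add: polar)
      then show ?case using polar_form_commute[of Q u "scale c x + y"] by simp
    qed
    then show ?thesis using L u(1) unfolding quadratic_lattice_def nondegenerate_on_def by blast
  qed
  obtain B where B: "B \<subseteq> L" "V.independent B" "L \<subseteq> V.span B" "card B = V.dim L"
    by (rule V.basis_exists)
  have "V.dim L \<ge> 2" using rank by (simp add: lattice_rank_def)
  then obtain x1 x2 where x: "x1 \<in> B" "x2 \<in> B" "x1 \<noteq> x2"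
    using B(4) by (metis One_nat_def card_le_Suc0_iff_eq card.infinite not_less_eq_eq numeral_2_eq_2 zero_le)
  have xL: "x1 \<in> L" "x2 \<in> L" using x B(1) by auto
  have "x1 \<noteq> 0" using B(2) x(1) V.dependent_zero by blast
  have "h x1 \<noteq> 0"
  proof
    assume "h x1 = 0"
    then have "polar_form Q x1 m = 0" if "m \<in> L" for m
      using rank_one[OF xL(1) that] by simp
    then show False using nondeg[OF V.span_base[OF xL(1)]] \<open>x1 \<noteq> 0\<close> by blast
  qed
  define p where "p = polar_form Q x1 x1"
  define q where "q = polar_form Q x1 x2"
  have "to_ac p \<noteq> 0" unfolding p_def sq[OF xL(1)] using \<open>h x1 \<noteq> 0\<close> by simp
  then have "p \<noteq> 0" by simp
  \<comment> \<open>With \<open>p\<close> the square of \<open>h x1\<close> and \<open>q\<close> the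
    product of \<open>h x1\<close> and \<open>h x2\<close>, this combination is annihilated by
    \<open>h\<close>, so it lies in the radical although \<open>x1\<close> and \<open>x2\<close> are
    independent.\<close>
  have "scale p x2 - scale q x1 = 0"
  proof (rule nondeg)
    show "scale p x2 - scale q x1 \<in> V.span L"
      by (intro V.span_diff V.span_scale V.span_base xL)
    fix m assume m: "m \<in> L"
    have "to_ac (polar_form Q (scale p x2 - scale q x1) m) = (h x1)\<^sup>2 * (h x2 * h m) - h x1 * h x2 * (h x1 * h m)"
      unfolding polar p_def q_def to_ac_diff to_ac_mult using rank_one xL m by (simp add: power2_eq_square)
    also have "\<dots> = 0" by (simp add: power2_eq_square)
    finally show "polar_form Q (scale p x2 - scale q x1) m = 0" by simp
  qed
  then have "scale (inverse p) (scale p x2) = scale (inverse p) (scale q x1)" by simp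
  then have "x2 = scale (inverse p * q) x1" using \<open>p \<noteq> 0\<close> by simp
  moreover have "x1 \<in> B - {x2}" using x by blast
  ultimately have "x2 \<in> V.span (B - {x2})" by (metis V.span_scale V.span_base)
  then show False using B(2) x(2) unfolding V.dependent_def by blast
qed

theorem theorem4p6:
  fixes scale :: "'k :: field_char_0 \<Rightarrow> 'v :: ab_group_add \<Rightarrow> 'v"
    and Q :: "'v \<Rightarrow> 'k"
    and L :: "'v set"
  assumes "number_field TYPE('k)"
    and "quadratic_space scale Q"
    and "quadratic_lattice scale Q L"
    and "lattice_rank scale L \<ge> 2"
  shows "potentially_universal scale Q L \<longleftrightarrow> potentially_represented scale Q L 1"
proof
  assume "potentially_universal scale Q L"
  moreover have "(1 :: 'k) \<in> ring_of_integers UNIV" by (simp add: ring_of_integers_def)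
  ultimately show "potentially_represented scale Q L 1"
    unfolding potentially_universal_def potentially_represented_def by blast
next
  note values_iff = extended_values_iff[OF assms(2,3)]
  assume "potentially_represented scale Q L 1"
  then obtain K1 where K1: "finite_extension K1" "1 \<in> extended_values scale Q L K1"
    unfolding potentially_represented_def by auto
  obtain f where f: "Poly_Mapping.keys f \<subseteq> L \<times> ring_of_integers K1" "formal_bilinear Q f f = 1"
    using K1(2) unfolding values_iff[OF K1(1)] by metis
  obtain l where l: "l \<in> L" "to_ac (polar_form Q l l) \<noteq> (formal_bilinear Q (frag_of (l, 1)) f)\<^sup>2"
    using anisotropic_projection[OF assms(2,3,4)] by blast
  define b where "b = formal_bilinear Q (frag_of (l, 1)) f"
  \<comment> \<open>The vector \<open>l - b * f\<close> is orthogonal to \<open>f\<close> and has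
    norm \<open>- c0\<^sup>2\<close>.\<close>
  obtain c0 where c0: "c0 ^ 2 = b\<^sup>2 - to_ac (polar_form Q l l)" using nth_root_exists[of 2] by auto
  have "c0 \<noteq> 0" using c0 l(2) unfolding b_def by auto
  obtain D1 where D1: "D1 > 0" "algebraic_int (of_nat D1 * b)"
    using alg_closure_denominator[OF assms(1)] by blast
  obtain D2 where D2: "D2 > 0" "algebraic_int (of_nat D2 * c0)"
    using alg_closure_denominator[OF assms(1)] by blast
  \<comment> \<open>A common denominator of \<open>b\<close> and \<open>c0\<close>: it makes the
    multiplier \<open>D * b\<close> admissible in the tensor product and \<open>c = D * c0\<close>
    integral.\<close>
  define D where "D = (of_nat (D1 * D2) :: 'k alg_closure)"
  have D: "D \<noteq> 0" "algebraic_int D"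
    using D1(1) D2(1) unfolding D_def by (simp, intro algebraic_int_of_nat)
  have "D * b = of_nat D2 * (of_nat D1 * b)" "D * c0 = of_nat D1 * (of_nat D2 * c0)"
    by (simp_all add: D_def)
  then have int: "algebraic_int (D * b)" "algebraic_int (D * c0)"
    using D1(2) D2(2) by (simp_all only: algebraic_int_times algebraic_int_of_nat)
  define c where "c = D * c0"
  have c: "algebraic_int c" "c \<noteq> 0" using int D \<open>c0 \<noteq> 0\<close> by (simp_all add: c_def)
  \<comment> \<open>The multiple \<open>D * (l - b * f)\<close>, of norm \<open>- c\<^sup>2\<close>;
    together with \<open>f\<close> it spans a plane with form
    \<open>x\<^sup>2 - c\<^sup>2 * y\<^sup>2\<close>.\<close>
  define g where "g = frag_scale D (frag_of (l, 1)) - frag_scale (D * b) f"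
  have gf: "formal_bilinear Q g f = 0"
    by (simp add: g_def formal_bilinear_diff_left formal_bilinear_scale_left f(2) b_def)
  have fg: "formal_bilinear Q f g = 0" using gf by (simp add: formal_bilinear_commute)
  have lg: "formal_bilinear Q (frag_of (l, 1)) g = D * (to_ac (polar_form Q l l) - b\<^sup>2)"
  proof -
    have "formal_bilinear Q (frag_of (l, 1)) g = formal_bilinear Q g (frag_of (l, 1))"
      by (rule formal_bilinear_commute)
    also have "\<dots> = D * to_ac (polar_form Q l l) - D * b * formal_bilinear Q f (frag_of (l, 1))"
      by (simp add: g_def formal_bilinear_diff_left formal_bilinear_scale_left formal_bilinear_frag_of)
    also have "formal_bilinear Q f (frag_of (l, 1)) = b"
      unfolding b_def by (rule formal_bilinear_commute)
    finally show ?thesis by (simp add: power2_eq_square right_diff_distrib)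
  qed
  have "formal_bilinear Q g g = D * formal_bilinear Q (frag_of (l, 1)) g - D * b * formal_bilinear Q f g"
    by (subst (1) g_def) (simp only: formal_bilinear_diff_left formal_bilinear_scale_left)
  then have gg: "formal_bilinear Q g g = - (c\<^sup>2)"
    unfolding fg lg c_def power_mult_distrib c0 by (simp add: power2_eq_square algebra_simps)
  obtain E where E: "finite E" "\<forall>K. finite_extension K \<longrightarrow> E \<subseteq> K \<longrightarrow>
      (\<forall>a. algebraic_int a \<longrightarrow> (\<exists>x\<in>ring_of_integers K. \<exists>y\<in>ring_of_integers K.
        x\<^sup>2 - c\<^sup>2 * y\<^sup>2 = to_ac a))"
    using binary_form_universal[OF assms(1) c] by (elim exE conjE)
  \<comment> \<open>Besides \<open>E\<close>, the extension has to contain the scalars in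
    \<open>f\<close> and the multiplier \<open>D * b\<close>, so that \<open>f\<close> and
    \<open>g\<close> are combinations over \<open>K\<close>.\<close>
  let ?E = "insert (D * b) (E \<union> snd ` Poly_Mapping.keys f)"
  obtain K where K: "finite_extension K" "?E \<subseteq> K"
    using finite_extension_exists[of ?E] E(1) by auto
  have sub: "subfield K ring_of_type_algebra" and ac: "\<And>b. to_ac b \<in> K"
    using K(1) by (auto simp: finite_extension_def)
  note closed = subfield_type_algebra_closed[OF sub]
  have O_mult: "x * y \<in> ring_of_integers K" if "x \<in> ring_of_integers K" "y \<in> ring_of_integers K" for x y
    using that closed(1) by (auto simp: ring_of_integers_def)
  have scale_keys: "Poly_Mapping.keys (frag_scale x u) \<subseteq> L \<times> ring_of_integers K"
    if u: "Poly_Mapping.keys u \<subseteq> L \<times> ring_of_integers K" and x: "x \<in> ring_of_integers K" for x u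
  proof
    fix p assume "p \<in> Poly_Mapping.keys (frag_scale x u)"
    then obtain r where r: "r \<in> Poly_Mapping.keys u" "p = (fst r, x * snd r)"
      using keys_frag_scale by blast
    then have "fst r \<in> L" "snd r \<in> ring_of_integers K" using u by auto
    then show "p \<in> L \<times> ring_of_integers K" using r(2) O_mult x by auto
  qed
  have "D \<in> K" using ac[of "of_nat (D1 * D2)"] unfolding D_def to_ac_of_nat .
  then have D_O: "D \<in> ring_of_integers K" using D(2) by (simp add: ring_of_integers_def)
  have "D * b \<in> ring_of_integers K" using int(1) K(2) by (simp add: ring_of_integers_def)
  moreover have f_keys: "Poly_Mapping.keys f \<subseteq> L \<times> ring_of_integers K"
    using f(1) K(2) by (force simp: ring_of_integers_def)
  moreover have "Poly_Mapping.keys (frag_of (l, 1)) \<subseteq> L \<times> ring_of_integers K"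
    using l(1) ac[of 1] by (simp add: ring_of_integers_def)
  ultimately have g_keys: "Poly_Mapping.keys g \<subseteq> L \<times> ring_of_integers K"
    unfolding g_def using D_O scale_keys by (intro keys_diff_subset)
  have "to_ac a \<in> extended_values scale Q L K" if a: "algebraic_int a" for a
  proof -
    obtain x y where xy: "x \<in> ring_of_integers K" "y \<in> ring_of_integers K" "x\<^sup>2 - c\<^sup>2 * y\<^sup>2 = to_ac a"
      using E(2)[rule_format, OF K(1) _ a] K(2) by auto
    let ?h = "frag_scale x f + frag_scale y g"
    have "formal_bilinear Q ?h ?h = x\<^sup>2 - c\<^sup>2 * y\<^sup>2"
      by (simp add: formal_bilinear_add_left formal_bilinear_add_right formal_bilinear_scale_left
          formal_bilinear_scale_right f(2) gf fg gg power2_eq_square mult_ac)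
    moreover have "Poly_Mapping.keys ?h \<subseteq> L \<times> ring_of_integers K"
      using scale_keys[OF f_keys xy(1)] scale_keys[OF g_keys xy(2)] keys_add[of "frag_scale x f" "frag_scale y g"]
      by blast
    ultimately show ?thesis unfolding values_iff[OF K(1)] using xy(3) by metis
  qed
  then show "potentially_universal scale Q L"
    unfolding potentially_universal_def using K(1) by (auto simp: ring_of_integers_def)
qed

end
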